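(* Let $\mathbb{K}$ be a field of characteristic zero and let $G$ be any graph (loopless, multiple edges allowed) on the vertex set $\{0,1,\dots,n\}$. Then the algebras $\mathcal{D}_G$ and $\mathcal{K}_G$ defined below are isomorphic as filtered algebras.
   Context: $\Phi_G$ is the commutative $\mathbb{K}$-algebra generated by variables $\phi_e$, one for each edge $e$ of $G$, with relations $\phi_e^2=0$. For a vertex $i$ and edge $e$: $c_{i,e}=1$ if $e$ joins $i$ to $j$ with $i<j$, $c_{i,e}=-1$ if $e$ joins $i$ to $j$ with $i>j$, and $c_{i,e}=0$ if $e$ is not incident to $i$. $X_i=\sum_e c_{i,e}\phi_e$ and $Y_i=\exp(X_i)=\prod_e(1+c_{i,e}\phi_e)$, $i=0,\dots,n$. $\mathcal{K}_G$ is the subalgebra of $\Phi_G$ generated by $1,Y_0,\dots,Y_n$, with the filtration whose $k$-th piece is the linear span of all products of at most $k$ of the elements $Y_0,\dots,Y_n$ (the empty product being $1$). For a set $I$ of vertices, $D_I$ is the number of edges with exactly one endpoint in $I$. $\mathcal{D}_G=\mathbb{K}[y_0,\dots,y_n]/\mathcal{I}_G$, where $\mathcal{I}_G$ is generated by $\left(\prod_{i\in I}y_i-1\right)^{D_I+1}$ for all nonempty $I\subseteq\{0,\dots,n\}$; its filtration has $k$-th piece the image of the polynomials of total degree at most $k$. An isomorphism of filtered algebras is an algebra isomorphism mapping the $k$-th filtration piece onto the $k$-th filtration piece for every $k$. *)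

theory Defs
  imports
    "HOL-Library.Poly_Mapping"
    "HOL-Algebra.Algebra"
    "HOL-Algebra.Algebraic_Closure_Type"
begin

section \<open>Algebras over a field\<close>

text \<open>
  The field of scalars is a type of class \<^class>\<open>field\<close>; seen as a ring in the sense of
  \<open>HOL-Algebra\<close> it is \<^const>\<open>ring_of_type_algebra\<close>. An algebra over it is a record of type
  \<open>('k, 'a) module\<close> satisfying the locale \<^locale>\<open>algebra\<close>.
\<close>

definition lin_span :: "('k::field, 'a) module \<Rightarrow> 'a set \<Rightarrow> 'a set"
  where "lin_span A S = \<Inter>{B. submodule B (ring_of_type_algebra :: 'k ring) A \<and> S \<subseteq> B}"

definition gen_subalgebra :: "('k::field, 'a) module \<Rightarrow> 'a set \<Rightarrow> 'a set"
  where "gen_subalgebra A S =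
    \<Inter>{B. submodule B (ring_of_type_algebra :: 'k ring) A \<and> subring B A \<and> S \<subseteq> B}"

text \<open>The scalar multiplication follows the pattern of \<^const>\<open>rcoset_mult\<close>.\<close>

definition quot_alg :: "('k, 'a) module \<Rightarrow> 'a set \<Rightarrow> ('k, 'a set) module"
  where "quot_alg A I =
    ring.extend (A Quot I) (module.fields (\<lambda>c B. \<Union>x\<in>B. I +>\<^bsub>A\<^esub> (c \<odot>\<^bsub>A\<^esub> x)))"

definition filtered_alg_iso ::
  "('k, 'a) module \<Rightarrow> (nat \<Rightarrow> 'a set) \<Rightarrow> ('k, 'b) module \<Rightarrow> (nat \<Rightarrow> 'b set) \<Rightarrow> ('a \<Rightarrow> 'b) \<Rightarrow> bool"
  where "filtered_alg_iso A F B G f \<longleftrightarrow>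
    f \<in> ring_iso A B \<and>
    (\<forall>c. \<forall>x\<in>carrier A. f (c \<odot>\<^bsub>A\<^esub> x) = c \<odot>\<^bsub>B\<^esub> f x) \<and>
    (\<forall>k. f ` F k = G k)"

definition filtered_alg_isomorphic ::
  "('k, 'a) module \<Rightarrow> (nat \<Rightarrow> 'a set) \<Rightarrow> ('k, 'b) module \<Rightarrow> (nat \<Rightarrow> 'b set) \<Rightarrow> bool"
  where "filtered_alg_isomorphic A F B G \<longleftrightarrow> (\<exists>f. filtered_alg_iso A F B G f)"


section \<open>Polynomial algebras\<close>

text \<open>
  A polynomial is a finitely supported family of coefficients indexed by monomials, a monomial
  being a finitely supported family of exponents indexed by variables; multiplication on
  \<^type>\<open>poly_mapping\<close> is convolution.
\<close>

type_synonym ('x, 'k) mpoly = "('x \<Rightarrow>\<^sub>0 nat) \<Rightarrow>\<^sub>0 'k"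

definition Const :: "'k::comm_ring_1 \<Rightarrow> ('x, 'k) mpoly"
  where "Const c = Poly_Mapping.single 0 c"

definition Var :: "'x \<Rightarrow> ('x, 'k::comm_ring_1) mpoly"
  where "Var x = Poly_Mapping.single (Poly_Mapping.single x 1) 1"

definition mpoly_alg :: "'x set \<Rightarrow> ('k::comm_ring_1, ('x, 'k) mpoly) module"
  where "mpoly_alg V =
    \<lparr>carrier = {p. \<forall>m\<in>Poly_Mapping.keys p. Poly_Mapping.keys m \<subseteq> V},
     monoid.mult = (*), one = 1, ring.zero = 0, add = (+), module.smult = (\<lambda>c p. Const c * p)\<rparr>"

definition monom_degree :: "('x \<Rightarrow>\<^sub>0 nat) \<Rightarrow> nat"
  where "monom_degree m = (\<Sum>x\<in>Poly_Mapping.keys m. Poly_Mapping.lookup m x)"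

definition total_degree_le :: "nat \<Rightarrow> ('x, 'k::comm_ring_1) mpoly \<Rightarrow> bool"
  where "total_degree_le k p \<longleftrightarrow> (\<forall>m\<in>Poly_Mapping.keys p. monom_degree m \<le> k)"


section \<open>Graphs\<close>

text \<open>
  Edges are the elements of an abstract set \<open>E\<close>, and \<open>ends e\<close> is the set of the two end points
  of \<open>e\<close>; as \<open>ends\<close> need not be injective, parallel edges are allowed.
\<close>

definition loopless_multigraph :: "nat \<Rightarrow> 'e set \<Rightarrow> ('e \<Rightarrow> nat set) \<Rightarrow> bool"
  where "loopless_multigraph n E ends \<longleftrightarrow>
    finite E \<and> (\<forall>e\<in>E. ends e \<subseteq> {0..n} \<and> card (ends e) = 2)"

definition inc_sign :: "('e \<Rightarrow> nat set) \<Rightarrow> nat \<Rightarrow> 'e \<Rightarrow> 'k::comm_ring_1"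
  where "inc_sign ends i e =
    (if \<exists>j. ends e = {i, j} \<and> i < j then 1
     else if \<exists>j. ends e = {i, j} \<and> i > j then -1
     else 0)"

definition cut_size :: "'e set \<Rightarrow> ('e \<Rightarrow> nat set) \<Rightarrow> nat set \<Rightarrow> nat"
  where "cut_size E ends I = card {e \<in> E. card (ends e \<inter> I) = 1}"


section \<open>The algebra \<open>K\<^sub>G\<close>\<close>

definition Phi_ideal :: "'e set \<Rightarrow> ('e, 'k::field) mpoly set"
  where "Phi_ideal E = genideal (mpoly_alg E) {Var e ^ 2 | e. e \<in> E}"

definition Phi_alg :: "'e set \<Rightarrow> ('k::field, ('e, 'k) mpoly set) module"
  where "Phi_alg E = quot_alg (mpoly_alg E) (Phi_ideal E)"

definition phi :: "'e set \<Rightarrow> 'e \<Rightarrow> ('e, 'k::field) mpoly set"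
  where "phi E e = Phi_ideal E +>\<^bsub>mpoly_alg E\<^esub> Var e"

text \<open>
  As \<open>\<phi>\<^sub>e\<^sup>2 = 0\<close>, this product is the exponential of \<open>\<Sum>\<^sub>e c\<^sub>i\<^sub>,\<^sub>e \<phi>\<^sub>e\<close>.
\<close>

definition Y_gen :: "'e set \<Rightarrow> ('e \<Rightarrow> nat set) \<Rightarrow> nat \<Rightarrow> ('e, 'k::field) mpoly set"
  where "Y_gen E ends i =
    finprod (Phi_alg E :: ('k, ('e, 'k) mpoly set) module)
      (\<lambda>e. \<one>\<^bsub>Phi_alg E :: ('k, ('e, 'k) mpoly set) module\<^esub> \<oplus>\<^bsub>Phi_alg E\<^esub>
            (inc_sign ends i e :: 'k) \<odot>\<^bsub>Phi_alg E\<^esub> phi E e) E"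

definition K_alg :: "nat \<Rightarrow> 'e set \<Rightarrow> ('e \<Rightarrow> nat set) \<Rightarrow> ('k::field, ('e, 'k) mpoly set) module"
  where "K_alg n E ends =
    (Phi_alg E)\<lparr>carrier :=
      gen_subalgebra (Phi_alg E :: ('k, ('e, 'k) mpoly set) module)
        (insert \<one>\<^bsub>Phi_alg E :: ('k, ('e, 'k) mpoly set) module\<^esub> (Y_gen E ends ` {0..n}))\<rparr>"

definition K_filtration ::
  "nat \<Rightarrow> 'e set \<Rightarrow> ('e \<Rightarrow> nat set) \<Rightarrow> nat \<Rightarrow> ('e, 'k::field) mpoly set set"
  where "K_filtration n E ends k =
    lin_span (Phi_alg E :: ('k, ('e, 'k) mpoly set) module)
      {foldr (\<lambda>i y. Y_gen E ends i \<otimes>\<^bsub>Phi_alg E :: ('k, ('e, 'k) mpoly set) module\<^esub> y) vs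
         \<one>\<^bsub>Phi_alg E :: ('k, ('e, 'k) mpoly set) module\<^esub>
       | vs. set vs \<subseteq> {0..n} \<and> length vs \<le> k}"


section \<open>The algebra \<open>D\<^sub>G\<close>\<close>

definition D_ideal :: "nat \<Rightarrow> 'e set \<Rightarrow> ('e \<Rightarrow> nat set) \<Rightarrow> (nat, 'k::field) mpoly set"
  where "D_ideal n E ends =
    genideal (mpoly_alg {0..n})
      {((\<Prod>i\<in>I. Var i) - 1) ^ (cut_size E ends I + 1) | I. I \<noteq> {} \<and> I \<subseteq> {0..n}}"

definition D_alg :: "nat \<Rightarrow> 'e set \<Rightarrow> ('e \<Rightarrow> nat set) \<Rightarrow> ('k::field, (nat, 'k) mpoly set) module"
  where "D_alg n E ends = quot_alg (mpoly_alg {0..n}) (D_ideal n E ends)"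

definition D_filtration ::
  "nat \<Rightarrow> 'e set \<Rightarrow> ('e \<Rightarrow> nat set) \<Rightarrow> nat \<Rightarrow> (nat, 'k::field) mpoly set set"
  where "D_filtration n E ends k =
    {D_ideal n E ends +>\<^bsub>mpoly_alg {0..n}\<^esub> p | p.
       p \<in> carrier (mpoly_alg {0..n} :: ('k, (nat, 'k) mpoly) module) \<and> total_degree_le k p}"


section \<open>Well-definedness\<close>

lemma mpoly_alg_cring: "cring (mpoly_alg V :: ('k::comm_ring_1, ('x, 'k) mpoly) module)"
proof -
  let ?R = "mpoly_alg V :: ('k, ('x, 'k) mpoly) module"
  have add: "p + q \<in> carrier ?R" if "p \<in> carrier ?R" "q \<in> carrier ?R" for p q
    using that keys_add[of p q] by (auto simp: mpoly_alg_def)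
  have mult: "p * q \<in> carrier ?R" if "p \<in> carrier ?R" "q \<in> carrier ?R" for p q
  proof -
    have "Poly_Mapping.keys m \<subseteq> V" if m: "m \<in> Poly_Mapping.keys (p * q)" for m
    proof -
      obtain a b where "m = a + b" "a \<in> Poly_Mapping.keys p" "b \<in> Poly_Mapping.keys q"
        using keys_mult[of p q] m by blast
      thus ?thesis using keys_add[of a b] \<open>p \<in> _\<close> \<open>q \<in> _\<close> by (fastforce simp: mpoly_alg_def)
    qed
    thus ?thesis by (simp add: mpoly_alg_def)
  qed
  show ?thesis
  proof (rule cringI)
    show "abelian_group ?R"
    proof (rule abelian_groupI)
      fix x assume "x \<in> carrier ?R"
      thus "\<exists>y\<in>carrier ?R. y \<oplus>\<^bsub>?R\<^esub> x = \<zero>\<^bsub>?R\<^esub>"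
        by (intro bexI[of _ "- x"]) (auto simp: mpoly_alg_def)
    next
      show "p \<oplus>\<^bsub>?R\<^esub> q \<in> carrier ?R" if "p \<in> carrier ?R" "q \<in> carrier ?R" for p q
        using add[OF that] by (simp add: mpoly_alg_def)
    qed (simp_all add: mpoly_alg_def add.assoc add.commute)
    show "comm_monoid ?R"
    proof (rule comm_monoidI)
      show "p \<otimes>\<^bsub>?R\<^esub> q \<in> carrier ?R" if "p \<in> carrier ?R" "q \<in> carrier ?R" for p q
        using mult[OF that] by (simp add: mpoly_alg_def)
    qed (simp_all add: mpoly_alg_def mult.assoc mult.commute)
  qed (simp add: mpoly_alg_def distrib_right)
qed

lemma mpoly_alg_algebra:
  "algebra (ring_of_type_algebra :: 'k ring) (mpoly_alg V :: ('k::field, ('x, 'k) mpoly) module)"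
proof -
  let ?R = "mpoly_alg V :: ('k, ('x, 'k) mpoly) module"
  interpret cring ?R by (rule mpoly_alg_cring)
  have C: "Const c \<in> carrier ?R" for c
    by (auto simp: mpoly_alg_def Const_def)
  have m: "p * q \<in> carrier ?R" if "p \<in> carrier ?R" "q \<in> carrier ?R" for p q
    using m_closed[OF that] by (simp add: mpoly_alg_def)
  have Const_mult: "Const (c * d) = (Const c * Const d :: ('x, 'k) mpoly)" for c d
    by (simp add: Const_def mult_single)
  have Const_add: "Const (c + d) = (Const c + Const d :: ('x, 'k) mpoly)" for c d
    by (simp add: Const_def single_add)
  have Const_one: "Const 1 = (1 :: ('x, 'k) mpoly)"
    by (simp add: Const_def)
  have smult: "c \<odot>\<^bsub>?R\<^esub> p = Const c * p" for c p
    by (simp add: mpoly_alg_def)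
  show ?thesis
  proof (rule algebraI)
    show "cring (ring_of_type_algebra :: 'k ring)" by (rule cring_from_type_algebra)
    show "cring ?R" by (rule mpoly_alg_cring)
    show "c \<odot>\<^bsub>?R\<^esub> p \<in> carrier ?R" if "p \<in> carrier ?R" for c p
      using m[OF C that] by (simp add: smult)
  qed (simp_all add: mpoly_alg_def ring_of_type_algebra_def Const_mult Const_add Const_one
        distrib_left distrib_right mult.assoc)
qed

lemma quot_alg_simps:
  "carrier (quot_alg A I) = carrier (A Quot I)"
  "monoid.mult (quot_alg A I) = monoid.mult (A Quot I)"
  "one (quot_alg A I) = one (A Quot I)"
  "ring.zero (quot_alg A I) = ring.zero (A Quot I)"
  "add (quot_alg A I) = add (A Quot I)"
  "module.smult (quot_alg A I) = (\<lambda>c B. \<Union>x\<in>B. I +>\<^bsub>A\<^esub> (c \<odot>\<^bsub>A\<^esub> x))"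
  by (simp_all add: quot_alg_def ring.defs module.defs FactRing_def)

lemma quot_alg_smult:
  assumes "algebra R A" "ideal I A" "c \<in> carrier R" "p \<in> carrier A"
  shows "c \<odot>\<^bsub>quot_alg A I\<^esub> (I +>\<^bsub>A\<^esub> p) = I +>\<^bsub>A\<^esub> (c \<odot>\<^bsub>A\<^esub> p)"
proof -
  interpret A: algebra R A by fact
  interpret I: ideal I A by fact
  have *: "I +>\<^bsub>A\<^esub> (c \<odot>\<^bsub>A\<^esub> x) = I +>\<^bsub>A\<^esub> (c \<odot>\<^bsub>A\<^esub> p)" if x: "x \<in> I +>\<^bsub>A\<^esub> p" for x
  proof -
    obtain h where h: "h \<in> I" "x = h \<oplus>\<^bsub>A\<^esub> p"
      using x by (auto simp: a_r_coset_def')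
    have hc: "h \<in> carrier A" using h I.a_subset by auto
    have "c \<odot>\<^bsub>A\<^esub> h = (c \<odot>\<^bsub>A\<^esub> \<one>\<^bsub>A\<^esub>) \<otimes>\<^bsub>A\<^esub> h"
      using A.smult_assoc2[OF assms(3) _ hc, of "\<one>\<^bsub>A\<^esub>"] hc by simp
    hence "c \<odot>\<^bsub>A\<^esub> h \<in> I" using h assms by (simp add: I.I_l_closed)
    moreover have "c \<odot>\<^bsub>A\<^esub> x = c \<odot>\<^bsub>A\<^esub> h \<oplus>\<^bsub>A\<^esub> c \<odot>\<^bsub>A\<^esub> p"
      using h hc assms by (simp add: A.smult_r_distr)
    ultimately have "c \<odot>\<^bsub>A\<^esub> x \<in> I +>\<^bsub>A\<^esub> (c \<odot>\<^bsub>A\<^esub> p)"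
      by (auto simp: a_r_coset_def')
    thus ?thesis
      using I.a_repr_independence'[of "c \<odot>\<^bsub>A\<^esub> x" "c \<odot>\<^bsub>A\<^esub> p"] assms by simp
  qed
  have "p \<in> I +>\<^bsub>A\<^esub> p" using assms I.a_rcos_self by blast
  thus ?thesis unfolding quot_alg_simps using * by blast
qed

lemma quot_alg_algebra:
  assumes "algebra R A" "ideal I A"
  shows "algebra R (quot_alg A I)"
proof -
  interpret A: algebra R A by fact
  interpret I: ideal I A by fact
  let ?Q = "quot_alg A I"
  have car: "\<exists>p\<in>carrier A. x = I +>\<^bsub>A\<^esub> p" if "x \<in> carrier ?Q" for x
    using that by (auto simp: quot_alg_simps FactRing_def A_RCOSETS_def')
  have in_car: "I +>\<^bsub>A\<^esub> p \<in> carrier ?Q" if "p \<in> carrier A" for p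
    using that by (auto simp: quot_alg_simps FactRing_def A_RCOSETS_def')
  have ad: "(I +>\<^bsub>A\<^esub> p) \<oplus>\<^bsub>?Q\<^esub> (I +>\<^bsub>A\<^esub> q) = I +>\<^bsub>A\<^esub> (p \<oplus>\<^bsub>A\<^esub> q)"
    if "p \<in> carrier A" "q \<in> carrier A" for p q
    using that by (simp add: quot_alg_simps FactRing_def I.a_rcos_sum)
  have mu: "(I +>\<^bsub>A\<^esub> p) \<otimes>\<^bsub>?Q\<^esub> (I +>\<^bsub>A\<^esub> q) = I +>\<^bsub>A\<^esub> (p \<otimes>\<^bsub>A\<^esub> q)"
    if "p \<in> carrier A" "q \<in> carrier A" for p q
    using that by (simp add: quot_alg_simps FactRing_def I.rcoset_mult_add)
  have on: "\<one>\<^bsub>?Q\<^esub> = I +>\<^bsub>A\<^esub> \<one>\<^bsub>A\<^esub>"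
    by (simp add: quot_alg_simps FactRing_def)
  have ze: "\<zero>\<^bsub>?Q\<^esub> = I +>\<^bsub>A\<^esub> \<zero>\<^bsub>A\<^esub>"
    using A.M.a_coset_add_zero[OF I.a_subset] by (simp add: quot_alg_simps FactRing_def)
  have crQ: "cring ?Q"
  proof (rule cringI)
    show "abelian_group ?Q"
    proof (rule abelian_groupI)
      fix x assume "x \<in> carrier ?Q"
      then obtain p where "p \<in> carrier A" "x = I +>\<^bsub>A\<^esub> p" using car by blast
      thus "\<exists>y\<in>carrier ?Q. y \<oplus>\<^bsub>?Q\<^esub> x = \<zero>\<^bsub>?Q\<^esub>"
        by (intro bexI[of _ "I +>\<^bsub>A\<^esub> (\<ominus>\<^bsub>A\<^esub> p)"]) (simp_all add: ad ze in_car A.M.l_neg)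
    qed (auto dest!: car simp: ad ze in_car A.M.a_ac)
    show "comm_monoid ?Q"
      by (rule comm_monoidI) (auto dest!: car simp: mu on in_car A.m_ac)
  qed (auto dest!: car simp: ad mu in_car A.l_distr)
  note sm = quot_alg_smult[OF assms]
  show ?thesis
    by (rule algebraI)
      (auto dest!: car simp: A.R_cring crQ ad mu sm in_car A.smult_l_distr A.smult_r_distr
        A.smult_assoc1 A.smult_assoc2)
qed



lemma Var_carrier: "x \<in> V \<Longrightarrow> Var x \<in> carrier (mpoly_alg V :: ('k::comm_ring_1, ('x, 'k) mpoly) module)"
  by (auto simp: mpoly_alg_def Var_def)

lemma mpoly_alg_pow_carrier:
  assumes "p \<in> carrier (mpoly_alg V :: ('k::comm_ring_1, ('x, 'k) mpoly) module)"
  shows "p ^ k \<in> carrier (mpoly_alg V :: ('k::comm_ring_1, ('x, 'k) mpoly) module)"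
proof -
  let ?R = "mpoly_alg V :: ('k, ('x, 'k) mpoly) module"
  interpret cring ?R by (rule mpoly_alg_cring)
  show ?thesis
  proof (induction k)
    case 0 show ?case using one_closed by (simp add: mpoly_alg_def)
  next
    case (Suc k) thus ?case using m_closed[OF assms Suc] by (simp add: mpoly_alg_def)
  qed
qed

lemma Phi_ideal_ideal:
  "ideal (Phi_ideal E) (mpoly_alg E :: ('k::field, ('e, 'k) mpoly) module)"
  unfolding Phi_ideal_def
proof (rule ring.genideal_ideal)
  show "ring (mpoly_alg E :: ('k, ('e, 'k) mpoly) module)"
    by (rule cring.axioms(1)[OF mpoly_alg_cring])
  show "{Var e ^ 2 | e. e \<in> E} \<subseteq> carrier (mpoly_alg E :: ('k, ('e, 'k) mpoly) module)"
    by (blast intro: mpoly_alg_pow_carrier Var_carrier)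
qed

lemma Phi_alg_algebra:
  "algebra (ring_of_type_algebra :: 'k ring) (Phi_alg E :: ('k::field, ('e, 'k) mpoly set) module)"
  unfolding Phi_alg_def by (rule quot_alg_algebra[OF mpoly_alg_algebra Phi_ideal_ideal])

lemma D_ideal_ideal:
  "ideal (D_ideal n E ends) (mpoly_alg {0..n} :: ('k::field, (nat, 'k) mpoly) module)"
proof -
  let ?R = "mpoly_alg {0..n} :: ('k, (nat, 'k) mpoly) module"
  interpret cring ?R by (rule mpoly_alg_cring)
  have "(\<Prod>i\<in>I. Var i) - 1 \<in> carrier ?R" if "I \<subseteq> {0..n}" for I
  proof -
    have "finite I" using that finite_subset by blast
    hence "(\<Prod>i\<in>I. Var i) \<in> carrier ?R" using that
    proof induction
      case empty thus ?case using one_closed by (simp add: mpoly_alg_def)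
    next
      case (insert x F)
      have "Var x \<in> carrier ?R" using insert by (intro Var_carrier) auto
      from m_closed[OF this] insert show ?case by (simp add: mpoly_alg_def)
    qed
    thus ?thesis using keys_diff[of "\<Prod>i\<in>I. Var i :: (nat, 'k) mpoly" 1]
      by (fastforce simp: mpoly_alg_def)
  qed
  thus ?thesis unfolding D_ideal_def
    by (intro genideal_ideal) (blast intro: mpoly_alg_pow_carrier)
qed

lemma D_alg_algebra:
  "algebra (ring_of_type_algebra :: 'k ring) (D_alg n E ends :: ('k::field, (nat, 'k) mpoly set) module)"
  unfolding D_alg_def by (rule quot_alg_algebra[OF mpoly_alg_algebra D_ideal_ideal])

lemma Y_gen_closed:
  assumes "finite E"
  shows "Y_gen E ends i \<in> carrier (Phi_alg E :: ('k::field, ('e, 'k) mpoly set) module)"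
proof -
  let ?P = "Phi_alg E :: ('k, ('e, 'k) mpoly set) module"
  interpret P: algebra "ring_of_type_algebra :: 'k ring" ?P by (rule Phi_alg_algebra)
  have phi: "phi E e \<in> carrier ?P" if "e \<in> E" for e
    using that Var_carrier[of e E]
    by (auto simp: phi_def Phi_alg_def quot_alg_simps FactRing_def A_RCOSETS_def')
  have "c \<odot>\<^bsub>?P\<^esub> phi E e \<in> carrier ?P" if "e \<in> E" for e c
    using P.smult_closed[OF _ phi[OF that], of c] by (simp add: ring_of_type_algebra_def)
  thus ?thesis unfolding Y_gen_def by (intro P.finprod_closed) auto
qed

end

theory Submission
  imports Defs
begin

text \<open>
  Orient every edge \<open>e\<close> from its smaller end point \<open>s\<close> to its larger end point \<open>t\<close>. In \<open>\<Phi>\<^sub>G\<close> a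
  monomial \<open>y\<^sup>a\<close> is sent to \<open>\<Prod>\<^sub>e (1 + (a\<^sub>s - a\<^sub>t) \<phi>\<^sub>e)\<close>, whose coefficient at \<open>\<phi>\<^sub>S\<close> is
  \<open>l\<^sub>S(a) = \<Prod>\<^sub>e\<^sub>\<in>\<^sub>S (a\<^sub>s - a\<^sub>t)\<close>. A linear functional on the polynomial ring is a function \<open>F\<close> of the
  exponent vector \<open>a\<close>; it vanishes on the ideal \<open>I\<^sub>G\<close> iff the difference operator in direction \<open>1\<^sub>I\<close>
  satisfies \<open>\<Delta>\<^sub>I\<^sup>D\<^sup>+\<^sup>1 F = 0\<close> with \<open>D = D\<^sub>I\<close>, for every nonempty \<open>I\<close>. So the kernel of \<open>y\<^sub>i \<mapsto> Y\<^sub>i\<close> is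
  \<open>I\<^sub>G\<close> once every such \<open>F\<close> is shown to be a linear combination of the \<open>l\<^sub>S\<close>.

  This is proved by deletion and contraction of an edge \<open>e\<close> joining \<open>i\<close> and \<open>j\<close>. By Newton
  interpolation \<open>F\<close> is a polynomial. Its restriction to \<open>a\<^sub>i = a\<^sub>j\<close> satisfies the conditions for
  \<open>G/e\<close>, so by induction it agrees there with a combination of the \<open>l\<^sub>S\<close>, \<open>e \<notin> S\<close>. After
  subtracting that combination, \<open>F\<close> is \<open>a\<^sub>s - a\<^sub>t\<close> times a polynomial satisfying the conditions for
  \<open>G - e\<close>, which is covered by induction as well.
\<close>

section \<open>Difference operators on functions of exponent vectors\<close>

definition shift :: "'v set \<Rightarrow> ('v \<Rightarrow> nat) \<Rightarrow> 'v \<Rightarrow> nat"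
  where "shift I a = (\<lambda>i. if i \<in> I then Suc (a i) else a i)"

definition fdiff :: "'v set \<Rightarrow> (('v \<Rightarrow> nat) \<Rightarrow> 'k::ab_group_add) \<Rightarrow> ('v \<Rightarrow> nat) \<Rightarrow> 'k"
  where "fdiff I f = (\<lambda>a. f (shift I a) - f a)"

lemma fdiff_pow_zero: "(fdiff I ^^ k) (\<lambda>_. 0) = (\<lambda>_. 0)"
  by (induction k) (auto simp: fdiff_def)

lemma fdiff_pow_eq_zero_mono:
  assumes "(fdiff I ^^ k) f = (\<lambda>_. 0)" "k \<le> m"
  shows "(fdiff I ^^ m) f = (\<lambda>_. 0)"
proof -
  have "(fdiff I ^^ m) f = (fdiff I ^^ (m - k)) ((fdiff I ^^ k) f)"
    using assms(2) by (metis comp_apply funpow_add le_add_diff_inverse2)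
  thus ?thesis by (simp add: assms(1) fdiff_pow_zero)
qed

lemma fdiff_pow_add:
  "(fdiff I ^^ k) (\<lambda>a. f a + g a) = (\<lambda>a. (fdiff I ^^ k) f a + (fdiff I ^^ k) g a)"
  by (induction k) (auto simp: fdiff_def)

lemma fdiff_pow_diff:
  "(fdiff I ^^ k) (\<lambda>a. f a - g a) = (\<lambda>a. (fdiff I ^^ k) f a - (fdiff I ^^ k) g a)"
  by (induction k) (auto simp: fdiff_def)

lemma fdiff_pow_sum:
  "(fdiff I ^^ k) (\<lambda>a. \<Sum>x\<in>A. f x a) = (\<lambda>a. \<Sum>x\<in>A. (fdiff I ^^ k) (f x) a)"
  by (induction k) (auto simp: fdiff_def sum_subtractf)

text \<open>Leibniz rule: the first difference of \<open>l\<close> along \<open>I\<close> is the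
  constant \<open>c\<close>, so at most one difference can fall on \<open>l\<close> and two terms
  survive. The factor \<open>Suc k\<close> counts which one falls there; it is invertible in
  characteristic zero, which later permits division by \<open>l\<close>.\<close>

lemma fdiff_pow_mult_affine:
  fixes l h :: "('v \<Rightarrow> nat) \<Rightarrow> 'k::comm_ring_1"
  assumes "\<And>a. l (shift I a) = l a + c"
  shows "(fdiff I ^^ Suc k) (\<lambda>a. l a * h a) a =
    l a * (fdiff I ^^ Suc k) h a + of_nat (Suc k) * c * (fdiff I ^^ k) h (shift I a)"
proof (induction k arbitrary: a)
  case 0
  show ?case by (simp add: fdiff_def assms algebra_simps)
next
  case (Suc k)
  have S: "(fdiff I ^^ Suc m) g a = (fdiff I ^^ m) g (shift I a) - (fdiff I ^^ m) g a" for m a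
    and g :: "('v \<Rightarrow> nat) \<Rightarrow> 'k"
    by (simp add: fdiff_def)
  have "(fdiff I ^^ Suc (Suc k)) (\<lambda>a. l a * h a) a =
     (l a + c) * (fdiff I ^^ Suc k) h (shift I a) - l a * (fdiff I ^^ Suc k) h a
     + of_nat (Suc k) * c * (fdiff I ^^ Suc k) h (shift I a)"
    unfolding S[of "Suc k"] Suc.IH unfolding S[of k h "shift I a"] assms
    by (simp add: algebra_simps)
  thus ?case unfolding S[of "Suc k" h] by (simp add: algebra_simps)
qed

lemma fdiff_pow_mult_const:
  fixes l h :: "('v \<Rightarrow> nat) \<Rightarrow> 'k::comm_ring_1"
  assumes "\<And>a. l (shift I a) = l a"
  shows "(fdiff I ^^ k) (\<lambda>a. l a * h a) = (\<lambda>a. l a * (fdiff I ^^ k) h a)"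
  by (induction k) (auto simp: fdiff_def assms algebra_simps)

text \<open>Along the ray from \<open>a\<close> in direction \<open>I\<close> the function is
  polynomial, so zeros at all later points force a zero at the start. The induction passes to
  \<open>fdiff I u\<close>, which also vanishes at all later points; once it vanishes at
  \<open>a\<close>, the value of \<open>u\<close> at \<open>a\<close> is that at the next
  point.\<close>

lemma fdiff_nilpotent_eq_zero:
  assumes "(fdiff I ^^ k) u = (\<lambda>_. 0)" "\<And>t. u ((shift I ^^ Suc t) a) = 0"
  shows "u a = 0"
  using assms
proof (induction k arbitrary: u)
  case 0
  thus ?case by simp
next
  case (Suc k)
  have v: "fdiff I u ((shift I ^^ Suc t) a) = 0" for t
    using Suc.prems(2)[of t] Suc.prems(2)[of "Suc t"] by (simp add: fdiff_def)
  have "(fdiff I ^^ k) (fdiff I u) = (\<lambda>_. 0)"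
    using Suc.prems(1) by (simp add: funpow_swap1)
  from Suc.IH[OF this v] Suc.prems(2)[of 0] show ?case by (simp add: fdiff_def)
qed

text \<open>Polynomial functions are built Horner-style, one variable factor at a time, so that no
  induction meets a product of two polynomials. The set \<open>V\<close> records which coordinates
  may occur; it shrinks under contraction.\<close>

inductive_set polyfun :: "'v set \<Rightarrow> (('v \<Rightarrow> nat) \<Rightarrow> 'k::comm_ring_1) set" for V :: "'v set"
  where
    const: "(\<lambda>_. c) \<in> polyfun V"
  | add: "f \<in> polyfun V \<Longrightarrow> g \<in> polyfun V \<Longrightarrow> (\<lambda>a. f a + g a) \<in> polyfun V"
  | mult: "i \<in> V \<Longrightarrow> f \<in> polyfun V \<Longrightarrow> (\<lambda>a. of_nat (a i) * f a) \<in> polyfun V"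

lemma polyfun_smult: "f \<in> polyfun V \<Longrightarrow> (\<lambda>a. c * f a) \<in> polyfun V"
proof (induction rule: polyfun.induct)
  case (const d)
  show ?case by (rule polyfun.const)
next
  case (add f g)
  from polyfun.add[OF add.IH] show ?case by (simp add: distrib_left)
next
  case (mult i f)
  from polyfun.mult[OF mult.hyps(1) mult.IH] show ?case by (simp add: mult.left_commute)
qed

lemma polyfun_diff:
  assumes "f \<in> polyfun V" "g \<in> polyfun V"
  shows "(\<lambda>a. f a - g a) \<in> polyfun V"
  using polyfun.add[OF assms(1) polyfun_smult[OF assms(2), of "-1"]] by simp

lemma polyfun_sum:
  assumes "\<And>x. x \<in> A \<Longrightarrow> f x \<in> polyfun V"
  shows "(\<lambda>a. \<Sum>x\<in>A. f x a) \<in> polyfun V"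
  using assms by (induction A rule: infinite_finite_induct) (auto intro: polyfun.intros)

lemma polyfun_mono: "f \<in> polyfun V \<Longrightarrow> V \<subseteq> W \<Longrightarrow> f \<in> polyfun W"
  by (induction rule: polyfun.induct) (auto intro: polyfun.intros)

lemma polyfun_shift: "f \<in> polyfun V \<Longrightarrow> (\<lambda>a. f (shift I a)) \<in> polyfun V"
proof (induction rule: polyfun.induct)
  case (mult i f)
  from polyfun.add[OF polyfun.mult[OF mult.hyps(1) mult.IH]
      polyfun_smult[OF mult.IH, of "if i \<in> I then 1 else 0"]]
  show ?case by (cases "i \<in> I") (simp_all add: shift_def algebra_simps)
qed (auto intro: polyfun.intros)

lemma polyfun_fdiff_pow: "f \<in> polyfun V \<Longrightarrow> (fdiff I ^^ k) f \<in> polyfun V"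
  by (induction k) (auto simp: fdiff_def intro: polyfun_diff polyfun_shift)

text \<open>A coordinate is affine along \<open>I\<close> with slope 1 or 0, so by the Leibniz rule
  each variable factor raises the order of nilpotency by at most one.\<close>

lemma polyfun_fdiff_nilpotent:
  "f \<in> polyfun V \<Longrightarrow> \<exists>k. (fdiff I ^^ k) f = (\<lambda>_. 0)"
proof (induction rule: polyfun.induct)
  case (const c)
  have "(fdiff I ^^ 1) (\<lambda>_. c) = (\<lambda>_. 0)" by (simp add: fdiff_def)
  thus ?case by blast
next
  case (add f g)
  then obtain k m where "(fdiff I ^^ k) f = (\<lambda>_. 0)" "(fdiff I ^^ m) g = (\<lambda>_. 0)" by blast
  hence "(fdiff I ^^ (max k m)) f = (\<lambda>_. 0)" "(fdiff I ^^ (max k m)) g = (\<lambda>_. 0)"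
    by (auto intro: fdiff_pow_eq_zero_mono)
  hence "(fdiff I ^^ (max k m)) (\<lambda>a. f a + g a) = (\<lambda>_. 0)" by (simp add: fdiff_pow_add)
  thus ?case by blast
next
  case (mult i f)
  then obtain k where k: "(fdiff I ^^ k) f = (\<lambda>_. 0)" by blast
  have k': "(fdiff I ^^ Suc k) f = (\<lambda>_. 0)" using k by (rule fdiff_pow_eq_zero_mono) simp
  have "(fdiff I ^^ Suc k) (\<lambda>a. of_nat (a i) * f a) = (\<lambda>_. 0)"
  proof
    fix a
    show "(fdiff I ^^ Suc k) (\<lambda>a. of_nat (a i) * f a) a = 0"
      by (subst fdiff_pow_mult_affine[where c = "if i \<in> I then 1 else 0"])
        (simp_all only: k k', simp_all add: shift_def)
  qed
  thus ?case by blast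
qed

text \<open>On the hyperplane \<open>a i = a j\<close> every factor \<open>a i\<close> becomes
  \<open>a j\<close>, so the coordinate \<open>i\<close> disappears.\<close>

lemma polyfun_subst:
  "f \<in> polyfun V \<Longrightarrow> j \<in> V \<Longrightarrow> i \<noteq> j \<Longrightarrow> (\<lambda>a. f (a(i := a j))) \<in> polyfun (V - {i})"
proof (induction rule: polyfun.induct)
  case (mult m f)
  have "(if m = i then j else m) \<in> V - {i}" using mult by auto
  from polyfun.mult[OF this mult.IH[OF mult.prems]] show ?case by (cases "m = i") auto
qed (auto intro: polyfun.intros)

text \<open>Factor theorem for \<open>a i - a j\<close>. The quotient follows the construction of
  \<open>f\<close>: with \<open>f'\<close> the restriction,
  \<open>a i * f - a j * f' = a i * (f - f') + (a i - a j) * f'\<close>, and for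
  \<open>m \<noteq> i\<close> the factor \<open>a m\<close> passes to the quotient.\<close>

lemma polyfun_divide_diff:
  assumes "f \<in> polyfun V" "i \<in> V" "j \<in> V" "i \<noteq> j"
  shows "\<exists>h\<in>polyfun V. \<forall>a. f a - f (a(i := a j)) = (of_nat (a i) - of_nat (a j)) * h a"
  using assms(1)
proof (induction rule: polyfun.induct)
  case (const c)
  show ?case by (rule bexI[OF _ polyfun.const[of 0]]) simp
next
  case (add f g)
  then obtain h h' where
    "h \<in> polyfun V" "\<forall>a. f a - f (a(i := a j)) = (of_nat (a i) - of_nat (a j)) * h a"
    "h' \<in> polyfun V" "\<forall>a. g a - g (a(i := a j)) = (of_nat (a i) - of_nat (a j)) * h' a"
    by blast
  thus ?case
    by (intro bexI[OF _ polyfun.add[of h _ h']]) (simp_all add: distrib_left add_diff_add fun_upd_def)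
next
  case (mult m f)
  then obtain h where h:
    "h \<in> polyfun V" "\<And>a. f a - f (a(i := a j)) = (of_nat (a i) - of_nat (a j)) * h a"
    by blast
  let ?f' = "\<lambda>a. f (a(i := a j))"
  have f': "?f' \<in> polyfun V"
    using polyfun_mono[OF polyfun_subst[OF mult.hyps(2) assms(3,4)]] by blast
  have fa: "f a = f (a(i := a j)) + (of_nat (a i) - of_nat (a j)) * h a" for a
    using h(2)[of a] by (simp add: algebra_simps)
  show ?case
  proof (intro bexI[OF _ polyfun.add[OF polyfun.mult[OF mult.hyps(1) h(1)]
          polyfun_smult[OF f', of "if m = i then 1 else 0"]]] allI)
    fix a
    show "of_nat (a m) * f a - of_nat ((a(i := a j)) m) * f (a(i := a j)) =
      (of_nat (a i) - of_nat (a j)) * (of_nat (a m) * h a + (if m = i then 1 else 0) * f (a(i := a j)))"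
      by (subst fa) (simp add: algebra_simps)
  qed
qed

text \<open>Off the hyperplane \<open>a i = a j\<close> the linear factor is invertible. A point on
  it starts a ray in direction \<open>i\<close> whose later points all lie off it, and nilpotency
  carries the zeros back to the start.\<close>

lemma polyfun_cancel_linear:
  fixes g :: "('v \<Rightarrow> nat) \<Rightarrow> 'k::field_char_0"
  assumes "g \<in> polyfun V" "i \<noteq> j" "\<And>a. (of_nat (a i) - of_nat (a j)) * g a = 0"
  shows "g = (\<lambda>_. 0)"
proof
  fix a
  have z: "g b = 0" if "b i \<noteq> b j" for b using assms(3)[of b] that by simp
  show "g a = 0"
  proof (cases "a i = a j")
    case True
    obtain k where k: "(fdiff {i} ^^ k) g = (\<lambda>_. 0)"
      using polyfun_fdiff_nilpotent[OF assms(1)] by blast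
    have "(shift {i} ^^ t) a = a(i := a i + t)" for t
      by (induction t) (auto simp: shift_def)
    hence "g ((shift {i} ^^ Suc t) a) = 0" for t
      using z[of "a(i := a i + Suc t)"] True assms(2) by (simp del: funpow.simps)
    from fdiff_nilpotent_eq_zero[OF k this] show ?thesis .
  qed (rule z)
qed

text \<open>The binomial coefficient of \<open>x\<close> over \<open>j + 1\<close> is the one over
  \<open>j\<close> times \<open>(x - j) / (j + 1)\<close>, hence a polynomial in \<open>x\<close>
  when the characteristic is zero.\<close>

lemma polyfun_binomial_mult:
  fixes g :: "('v \<Rightarrow> nat) \<Rightarrow> 'k::field_char_0"
  assumes "i \<in> V" "g \<in> polyfun V"
  shows "(\<lambda>a. of_nat (a i choose j) * g a) \<in> polyfun V"
proof (induction j)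
  case 0
  show ?case using assms by simp
next
  case (Suc j)
  let ?u = "\<lambda>a. of_nat (a i choose j) * g a"
  have "of_nat (a i choose Suc j) * g a =
      inverse (of_nat (Suc j)) * (of_nat (a i) * ?u a - of_nat j * ?u a)" for a
  proof -
    have "of_nat (Suc j) * (of_nat (a i choose Suc j) :: 'k) =
        (of_nat (a i) - of_nat j) * of_nat (a i choose j)"
    \<comment> \<open>For \<open>a i < j\<close> the natural number \<open>a i - j\<close> would be
      truncated; both binomial coefficients are then zero.\<close>
    proof (cases "j \<le> a i")
      case True
      have "Suc j * (a i choose Suc j) = (a i - j) * (a i choose j)"
        by (metis binomial_absorb_comp binomial_absorption)
      thus ?thesis using True by (metis of_nat_diff of_nat_mult)
    next
      case False
      thus ?thesis by (simp add: binomial_eq_0)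
    qed
    hence "inverse (of_nat (Suc j)) * ((of_nat (a i) - of_nat j) * of_nat (a i choose j)) =
        (of_nat (a i choose Suc j) :: 'k)"
      by (simp add: field_simps del: of_nat_Suc)
    hence "of_nat (a i choose Suc j) * g a =
        inverse (of_nat (Suc j)) * ((of_nat (a i) - of_nat j) * of_nat (a i choose j)) * g a"
      by simp
    thus ?thesis by (simp only: left_diff_distrib right_diff_distrib mult.assoc)
  qed
  moreover have "(\<lambda>a. inverse (of_nat (Suc j)) * (of_nat (a i) * ?u a - of_nat j * ?u a)) \<in> polyfun V"
    using Suc assms(1) by (intro polyfun_smult polyfun_diff polyfun.mult)
  ultimately show ?case by presburger
qed

section \<open>Newton interpolation on exponent vectors\<close>

lemma fdiff_commute: "fdiff I (fdiff J f) = fdiff J (fdiff I f)"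
proof -
  have "shift I (shift J a) = shift J (shift I a)" for a by (auto simp: shift_def)
  thus ?thesis by (auto simp: fdiff_def)
qed

lemma fdiff_pow_commute: "(fdiff I ^^ k) ((fdiff J ^^ m) f) = (fdiff J ^^ m) ((fdiff I ^^ k) f)"
proof -
  have "fdiff I ((fdiff J ^^ m) f) = (fdiff J ^^ m) (fdiff I f)" for f :: "('a \<Rightarrow> nat) \<Rightarrow> 'b"
    by (induction m) (simp_all add: fdiff_commute[of I J])
  thus ?thesis by (induction k) simp_all
qed

text \<open>The outer induction expands the difference of \<open>f\<close>, which has lower order;
  the inner one climbs from \<open>m\<close> to \<open>Suc m\<close> by adding that
  difference.\<close>

lemma newton_expansion:
  fixes f :: "('v \<Rightarrow> nat) \<Rightarrow> 'k::comm_ring_1"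
  assumes "(fdiff {i} ^^ k) f = (\<lambda>_. 0)"
  shows "f (b(i := m)) = (\<Sum>j<k. of_nat (m choose j) * (fdiff {i} ^^ j) f (b(i := 0)))"
  using assms
proof (induction k arbitrary: f m)
  case 0
  thus ?case by simp
next
  case (Suc k)
  have "(fdiff {i} ^^ k) (fdiff {i} f) = (\<lambda>_. 0)"
    using Suc.prems by (simp add: funpow_swap1)
  note IH = Suc.IH[OF this]
  have D: "(fdiff {i} ^^ j) (fdiff {i} f) = (fdiff {i} ^^ Suc j) f" for j
    by (simp add: funpow_swap1)
  show ?case
  proof (induction m)
    case 0
    show ?case by (subst sum.lessThan_Suc_shift) simp
  next
    case (Suc m)
    have "shift {i} (b(i := m)) = b(i := Suc m)" by (auto simp: shift_def)
    hence "f (b(i := Suc m)) = f (b(i := m)) + fdiff {i} f (b(i := m))" by (simp add: fdiff_def)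
    also have "\<dots> = f (b(i := 0)) +
        (\<Sum>j<k. of_nat (m choose Suc j) * (fdiff {i} ^^ Suc j) f (b(i := 0))) +
        (\<Sum>j<k. of_nat (m choose j) * (fdiff {i} ^^ Suc j) f (b(i := 0)))"
      unfolding Suc.IH IH D by (subst sum.lessThan_Suc_shift) simp
    \<comment> \<open>Pascal's rule merges the two sums.\<close>
    also have "\<dots> = f (b(i := 0)) +
        (\<Sum>j<k. of_nat (Suc m choose Suc j) * (fdiff {i} ^^ Suc j) f (b(i := 0)))"
      by (simp add: sum.distrib[symmetric] algebra_simps del: funpow.simps)
    also have "\<dots> = (\<Sum>j<Suc k. of_nat (Suc m choose j) * (fdiff {i} ^^ j) f (b(i := 0)))"
      by (subst sum.lessThan_Suc_shift) simp
    finally show ?case .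
  qed
qed

text \<open>Newton expansion in one variable at a time: the coefficients depend on the remaining
  variables only, and stay nilpotent in those because differences commute.\<close>

lemma polyfun_of_fdiff_nilpotent:
  fixes f :: "('v \<Rightarrow> nat) \<Rightarrow> 'k::field_char_0"
  assumes "finite V" "\<And>a b. (\<And>i. i \<in> V \<Longrightarrow> a i = b i) \<Longrightarrow> f a = f b"
    "\<And>i. i \<in> V \<Longrightarrow> \<exists>k. (fdiff {i} ^^ k) f = (\<lambda>_. 0)"
  shows "f \<in> polyfun V"
  using assms
proof (induction V arbitrary: f rule: finite_induct)
  case empty
  have "f = (\<lambda>_. f (\<lambda>_. 0))" using empty(1) by blast
  thus ?case by (metis polyfun.const)
next
  case (insert i V)
  obtain k where k: "(fdiff {i} ^^ k) f = (\<lambda>_. 0)"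
    using insert.prems(2)[OF insertI1] by blast
  define g where "g = (\<lambda>j a. (fdiff {i} ^^ j) f (a(i := 0)))"
  have "g j \<in> polyfun V" for j
  proof (rule insert.IH)
    fix a b :: "'v \<Rightarrow> nat" assume ab: "\<And>v. v \<in> V \<Longrightarrow> a v = b v"
    have dep: "(fdiff {i} ^^ j) f c = (fdiff {i} ^^ j) f d"
      if "\<And>v. v \<in> insert i V \<Longrightarrow> c v = d v" for c d
      using that
    proof (induction j arbitrary: c d)
      case 0
      show ?case using insert.prems(1)[of c d] 0 by simp
    next
      case (Suc j)
      have "\<And>v. v \<in> insert i V \<Longrightarrow> shift {i} c v = shift {i} d v"
        using Suc.prems by (auto simp: shift_def)
      from Suc.IH[OF this] Suc.IH[OF Suc.prems] show ?case by (simp add: fdiff_def)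
    qed
    show "g j a = g j b" unfolding g_def by (rule dep) (use ab in auto)
  next
    fix i' assume i': "i' \<in> V"
    from insert.prems(2)[OF insertI2[OF this]]
    obtain k' where k': "(fdiff {i'} ^^ k') f = (\<lambda>_. 0)" by blast
    \<comment> \<open>As \<open>i' \<noteq> i\<close>, differences in direction \<open>i'\<close>
      commute with setting the coordinate \<open>i\<close> to zero.\<close>
    have "(fdiff {i'} ^^ m) (g j) = (\<lambda>a. (fdiff {i'} ^^ m) ((fdiff {i} ^^ j) f) (a(i := 0)))" for m
    proof (induction m)
      case 0
      show ?case by (simp add: g_def fun_upd_def)
    next
      case (Suc m)
      have "(shift {i'} a)(i := 0) = shift {i'} (a(i := 0))" for a
        using i' insert.hyps by (auto simp: shift_def)
      thus ?case using Suc by (simp add: fdiff_def fun_upd_def)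
    qed
    hence "(fdiff {i'} ^^ k') (g j) = (\<lambda>_. 0)"
      by (simp add: fdiff_pow_commute[where I = "{i'}"] k' fdiff_pow_zero)
    thus "\<exists>k. (fdiff {i'} ^^ k) (g j) = (\<lambda>_. 0)" by blast
  qed
  hence "g j \<in> polyfun (insert i V)" for j by (rule polyfun_mono) auto
  hence "(\<lambda>a. \<Sum>j<k. of_nat (a i choose j) * g j a) \<in> polyfun (insert i V)"
    by (intro polyfun_sum polyfun_binomial_mult) auto
  moreover have "f a = (\<Sum>j<k. of_nat (a i choose j) * g j a)" for a
    using newton_expansion[OF k, of a "a i"] by (simp add: g_def)
  ultimately show ?case by presburger
qed

section \<open>Functions annihilated by powers of the cut differences\<close>

definition edge_form :: "('e \<Rightarrow> 'v) \<Rightarrow> ('e \<Rightarrow> 'v) \<Rightarrow> 'e \<Rightarrow> ('v \<Rightarrow> nat) \<Rightarrow> 'k::comm_ring_1"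
  where "edge_form s t e a = of_nat (a (s e)) - of_nat (a (t e))"

definition cut_edges :: "('e \<Rightarrow> 'v) \<Rightarrow> ('e \<Rightarrow> 'v) \<Rightarrow> 'e set \<Rightarrow> 'v set \<Rightarrow> 'e set"
  where "cut_edges s t E I = {e \<in> E. (s e \<in> I) \<noteq> (t e \<in> I)}"

lemma edge_form_shift:
  "edge_form s t e (shift I a) =
    edge_form s t e a + (of_bool (s e \<in> I) - of_bool (t e \<in> I) :: 'k::comm_ring_1)"
  by (simp add: edge_form_def shift_def)

section \<open>Products of edge forms\<close>

lemma polyfun_edge_prod:
  assumes "s ` S \<subseteq> V" "t ` S \<subseteq> V"
  shows "(\<lambda>a. \<Prod>e\<in>S. edge_form s t e a :: 'k::comm_ring_1) \<in> polyfun V"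
  using assms
proof (induction S rule: infinite_finite_induct)
  case (insert e S)
  hence "(\<lambda>a. of_nat (a (s e)) * (\<Prod>e\<in>S. edge_form s t e a :: 'k)
      - of_nat (a (t e)) * (\<Prod>e\<in>S. edge_form s t e a)) \<in> polyfun V"
    by (intro polyfun_diff polyfun.mult) auto
  thus ?case using insert.hyps by (simp add: edge_form_def left_diff_distrib)
qed (auto intro: polyfun.intros)

text \<open>Along \<open>I\<close> the form of a cut edge has slope 1 or -1 and that of any other
  edge is constant. The degree of the product along \<open>I\<close> is thus at most the number of
  cut edges, and one further difference kills it.\<close>

lemma fdiff_pow_edge_prod:
  assumes "finite S"
  shows "(fdiff I ^^ (card (cut_edges s t S I) + 1))
      (\<lambda>a. \<Prod>e\<in>S. edge_form s t e a :: 'k::comm_ring_1) = (\<lambda>_. 0)"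
  using assms
proof induction
  case empty
  show ?case by (simp add: fdiff_def cut_edges_def)
next
  case (insert e S)
  let ?h = "\<lambda>a. \<Prod>e\<in>S. edge_form s t e a :: 'k"
  let ?k = "card (cut_edges s t S I) + 1"
  have p: "(\<lambda>a. \<Prod>e\<in>insert e S. edge_form s t e a :: 'k) = (\<lambda>a. edge_form s t e a * ?h a)"
    using insert.hyps by simp
  show ?case
  proof (cases "(s e \<in> I) = (t e \<in> I)")
    case True
    hence "cut_edges s t (insert e S) I = cut_edges s t S I" by (auto simp: cut_edges_def)
    moreover have "(fdiff I ^^ ?k) (\<lambda>a. edge_form s t e a * ?h a) = (\<lambda>_. 0)"
      by (subst fdiff_pow_mult_const)
        (simp add: edge_form_shift True, simp only: insert.IH, simp)
    ultimately show ?thesis unfolding p by simp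
  next
    case False
    hence "cut_edges s t (insert e S) I = insert e (cut_edges s t S I)"
      by (auto simp: cut_edges_def)
    hence c: "card (cut_edges s t (insert e S) I) + 1 = Suc ?k"
      using insert.hyps by (simp add: cut_edges_def)
    have k': "(fdiff I ^^ Suc ?k) ?h = (\<lambda>_. 0)"
      using insert.IH by (rule fdiff_pow_eq_zero_mono) simp
    show ?thesis unfolding c p
    proof
      fix a
      show "(fdiff I ^^ Suc ?k) (\<lambda>a. edge_form s t e a * ?h a) a = 0"
        by (subst fdiff_pow_mult_affine[where c = "of_bool (s e \<in> I) - of_bool (t e \<in> I)"])
          (rule edge_form_shift, simp only: insert.IH k', simp)
    qed
  qed
qed

lemma fdiff_pow_edge_prod_subset:
  assumes "finite E" "S \<subseteq> E"
  shows "(fdiff I ^^ (card (cut_edges s t E I) + 1))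
      (\<lambda>a. \<Prod>e\<in>S. edge_form s t e a :: 'k::comm_ring_1) = (\<lambda>_. 0)"
proof (rule fdiff_pow_eq_zero_mono[OF fdiff_pow_edge_prod])
  show "finite S" using assms finite_subset by blast
  have "finite (cut_edges s t E I)" "cut_edges s t S I \<subseteq> cut_edges s t E I"
    using assms by (auto simp: cut_edges_def)
  thus "card (cut_edges s t S I) + 1 \<le> card (cut_edges s t E I) + 1"
    by (simp add: card_mono)
qed

text \<open>Shifting along \<open>I\<close> and then copying coordinate \<open>j\<close> to
  \<open>i\<close> is the same as copying first and then shifting along the preimage of
  \<open>I\<close> under the map sending \<open>i\<close> to \<open>j\<close>. This turns cut
  conditions of a graph into those of its contraction.\<close>

lemma fdiff_pow_contract:
  assumes "i \<noteq> j" "i \<notin> I"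
  shows "(fdiff I ^^ k) (\<lambda>a. f (a(i := a j))) =
    (\<lambda>a. (fdiff (if j \<in> I then insert i I else I) ^^ k) f (a(i := a j)))"
proof (induction k)
  case (Suc k)
  have "(shift I a)(i := shift I a j) = shift (if j \<in> I then insert i I else I) (a(i := a j))" for a
    using assms by (auto simp: shift_def)
  thus ?case using Suc by (simp add: fdiff_def fun_upd_def)
qed simp

text \<open>The edgeless case of the deletion-contraction induction, where every cut is empty. The
  coordinates in \<open>V\<close> are set to zero one after another; those outside \<open>V\<close>
  do not influence \<open>f\<close>.\<close>

lemma polyfun_fdiff_zero_const:
  assumes "f \<in> polyfun V" "finite V" "\<And>i. i \<in> V \<Longrightarrow> fdiff {i} f = (\<lambda>_. 0)"
  shows "f a = f (\<lambda>_. 0)"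
proof -
  have dep: "g a = g b" if "g \<in> polyfun V" "\<And>i. i \<in> V \<Longrightarrow> a i = b i" 
    for g :: "('a \<Rightarrow> nat) \<Rightarrow> 'b" and a b
    using that by (induction rule: polyfun.induct) auto
  have set: "f (b(i := m)) = f (b(i := 0))" if "i \<in> V" for b i m
  proof (induction m)
    case (Suc m)
    have "fdiff {i} f (b(i := m)) = 0" using assms(3)[OF that] by simp
    moreover have "shift {i} (b(i := m)) = b(i := Suc m)" by (auto simp: shift_def)
    ultimately show ?case using Suc by (simp add: fdiff_def fun_upd_def)
  qed simp
  have "f (\<lambda>i. if i \<in> W then 0 else a i) = f a" if "finite W" "W \<subseteq> V" for W
    using that
  proof induction
    case (insert i W)
    let ?b = "\<lambda>i. if i \<in> W then 0 else a i"
    have "(\<lambda>m. if m \<in> insert i W then 0 else a m) = ?b(i := 0)" by auto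
    moreover have "?b = ?b(i := a i)" using insert.hyps by auto
    ultimately show ?case using set[of i ?b "a i"] insert by (metis insert_subset)
  qed simp
  from this[OF assms(2)] have "f (\<lambda>i. if i \<in> V then 0 else a i) = f a" by simp
  moreover have "f (\<lambda>i. if i \<in> V then 0 else a i) = f (\<lambda>_. 0)"
    by (rule dep[OF assms(1)]) simp
  ultimately show ?thesis by simp
qed

section \<open>Deletion of an edge, and the spanning theorem\<close>

lemma card_cut_edges_insert:
  assumes "finite E" "e \<notin> E"
  shows "card (cut_edges s t (insert e E) I) =
    card (cut_edges s t E I) + (if (s e \<in> I) = (t e \<in> I) then 0 else 1)"
proof -
  have "cut_edges s t (insert e E) I =
      (if (s e \<in> I) = (t e \<in> I) then cut_edges s t E I else insert e (cut_edges s t E I))"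
    by (auto simp: cut_edges_def)
  thus ?thesis using assms by (simp add: cut_edges_def)
qed

text \<open>If \<open>e\<close> does not cross the cut, its form commutes with the differences and
  is cancelled. If it does, the order is lowered step by step: once \<open>j + 1\<close> differences
  kill \<open>h\<close>, the Leibniz rule leaves only the term with the \<open>j\<close>-th
  difference of \<open>h\<close>, whose coefficient \<open>(j + 1) * c\<close> is nonzero.\<close>

lemma fdiff_pow_divide_edge_form:
  fixes h :: "('v \<Rightarrow> nat) \<Rightarrow> 'k::field_char_0"
  assumes h: "h \<in> polyfun V" and e: "s e \<noteq> t e"
    and k: "(fdiff I ^^ (k + (if (s e \<in> I) = (t e \<in> I) then 0 else 1) + 1))
      (\<lambda>a. edge_form s t e a * h a) = (\<lambda>_. 0)"
  shows "(fdiff I ^^ (k + 1)) h = (\<lambda>_. 0)"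
proof (cases "(s e \<in> I) = (t e \<in> I)")
  case True
  have "(fdiff I ^^ (k + 1)) (\<lambda>a. edge_form s t e a * h a) = (\<lambda>_. 0)"
    using k unfolding True by simp
  moreover have "(fdiff I ^^ (k + 1)) (\<lambda>a. edge_form s t e a * h a) =
      (\<lambda>a. edge_form s t e a * (fdiff I ^^ (k + 1)) h a)"
    by (rule fdiff_pow_mult_const) (simp add: edge_form_shift True)
  ultimately have "edge_form s t e a * (fdiff I ^^ (k + 1)) h a = 0" for a
    by (simp only: fun_eq_iff)
  thus ?thesis
    by (intro polyfun_cancel_linear[OF polyfun_fdiff_pow[OF h] e]) (simp only: edge_form_def)
next
  case False
  define c :: 'k where "c = of_bool (s e \<in> I) - of_bool (t e \<in> I)"
  have c: "c \<noteq> 0" using False by (auto simp: c_def)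
  let ?f = "\<lambda>a. edge_form s t e a * h a"
  obtain m where m: "(fdiff I ^^ m) h = (\<lambda>_. 0)" using polyfun_fdiff_nilpotent[OF h] by blast
  \<comment> \<open>Descent on the excess \<open>d\<close>, started from the order \<open>m\<close>
    at which the polynomial \<open>h\<close> is nilpotent.\<close>
  have "(fdiff I ^^ (k + 1 + d)) h = (\<lambda>_. 0) \<Longrightarrow> (fdiff I ^^ (k + 1)) h = (\<lambda>_. 0)" for d
  proof (induction d)
    case (Suc d)
    let ?j = "k + 1 + d"
    have z: "(fdiff I ^^ Suc ?j) h = (\<lambda>_. 0)" using Suc.prems by simp
    have f: "(fdiff I ^^ Suc ?j) ?f = (\<lambda>_. 0)"
      using k False by (intro fdiff_pow_eq_zero_mono[OF k]) simp
    have sh: "(fdiff I ^^ ?j) h (shift I a) = 0" for a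
    proof -
      have "(fdiff I ^^ Suc ?j) ?f a = edge_form s t e a * (fdiff I ^^ Suc ?j) h a
          + of_nat (Suc ?j) * c * (fdiff I ^^ ?j) h (shift I a)"
        by (rule fdiff_pow_mult_affine) (simp add: edge_form_shift c_def)
      hence "of_nat (Suc ?j) * c * (fdiff I ^^ ?j) h (shift I a) = 0"
        unfolding f z by simp
      thus ?thesis using c by (simp del: of_nat_Suc)
    qed
    \<comment> \<open>So far only shifted arguments are covered. As the next difference vanishes,
      the value at \<open>a\<close> equals that at \<open>shift I a\<close>.\<close>
    have "(fdiff I ^^ ?j) h a = 0" for a
    proof -
      have "fdiff I ((fdiff I ^^ ?j) h) a = 0" using z by simp
      thus ?thesis using sh[of a] unfolding fdiff_def[of I "(fdiff I ^^ ?j) h"] by simp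
    qed
    hence "(fdiff I ^^ ?j) h = (\<lambda>_. 0)" by blast
    thus ?case by (rule Suc.IH)
  qed simp
  from this[of m] fdiff_pow_eq_zero_mono[OF m, of "k + 1 + m"] show ?thesis by simp
qed

text \<open>\<open>V\<close>, \<open>s\<close> and \<open>t\<close> vary in the induction on the
  edges because contraction removes a vertex and redirects edges.\<close>

lemma polyfun_in_edge_span:
  fixes f :: "('v \<Rightarrow> nat) \<Rightarrow> 'k::field_char_0"
  assumes "finite E" "finite V" "s ` E \<subseteq> V" "t ` E \<subseteq> V" "f \<in> polyfun V"
    "\<And>I. I \<noteq> {} \<Longrightarrow> I \<subseteq> V \<Longrightarrow> (fdiff I ^^ (card (cut_edges s t E I) + 1)) f = (\<lambda>_. 0)"
  shows "\<exists>c. \<forall>a. f a = (\<Sum>S\<in>Pow E. c S * (\<Prod>e\<in>S. edge_form s t e a))"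
  using assms
proof (induction E arbitrary: V s t f rule: finite_induct)
  case empty
  have "fdiff {i} f = (\<lambda>_. 0)" if "i \<in> V" for i
    using empty.prems(5)[of "{i}"] that by (simp add: cut_edges_def)
  from polyfun_fdiff_zero_const[OF empty.prems(4,1) this] have "f a = f (\<lambda>_. 0)" for a .
  thus ?case by (intro exI[of _ "\<lambda>_. f (\<lambda>_. 0)"]) simp
next
  case (insert e E)
  show ?case
  proof (cases "s e = t e")
    case True
    \<comment> \<open>A loop crosses no cut, so the conditions for \<open>E\<close> already hold;
      sets containing the loop receive coefficient zero.\<close>
    have "\<exists>c. \<forall>a. f a = (\<Sum>S\<in>Pow E. c S * (\<Prod>e\<in>S. edge_form s t e a))"
    proof (rule insert.IH[OF insert.prems(1) _ _ insert.prems(4)])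
      fix I assume "I \<noteq> {}" "I \<subseteq> V"
      from insert.prems(5)[OF this]
      show "(fdiff I ^^ (card (cut_edges s t E I) + 1)) f = (\<lambda>_. 0)"
        unfolding card_cut_edges_insert[OF insert.hyps] True by simp
    qed (use insert.prems in auto)
    then obtain c where c: "\<And>a. f a = (\<Sum>S\<in>Pow E. c S * (\<Prod>e\<in>S. edge_form s t e a))" by blast
    show ?thesis
    proof (intro exI allI)
      fix a
      show "f a = (\<Sum>S\<in>Pow (insert e E). (if S \<subseteq> E then c S else 0) * (\<Prod>e\<in>S. edge_form s t e a))"
        unfolding c using insert.hyps by (intro sum.mono_neutral_cong_left) auto
    qed
  next
    case False
    define i j where "i = s e" and "j = t e"
    have ij: "i \<in> V" "j \<in> V" "i \<noteq> j" using insert.prems False by (auto simp: i_def j_def)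
    \<comment> \<open>The vertex map of the contraction; edges parallel to \<open>e\<close> become
      loops.\<close>
    define r where "r = (\<lambda>v. if v = i then j else v)"
    have form_r: "edge_form (r \<circ> s) (r \<circ> t) d a = (edge_form s t d (a(i := a j)) :: 'k)" for d a
      by (simp add: edge_form_def r_def)
    have "\<exists>c. \<forall>a. f (a(i := a j)) =
        (\<Sum>S\<in>Pow E. c S * (\<Prod>d\<in>S. edge_form (r \<circ> s) (r \<circ> t) d a))"
    proof (rule insert.IH[of "V - {i}"])
      show "(\<lambda>a. f (a(i := a j))) \<in> polyfun (V - {i})"
        by (rule polyfun_subst[OF insert.prems(4) ij(2,3)])
      show "finite (V - {i})" using insert.prems by simp
      show "(r \<circ> s) ` E \<subseteq> V - {i}" "(r \<circ> t) ` E \<subseteq> V - {i}"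
        using insert.prems ij by (auto simp: r_def)
      fix I assume I: "I \<noteq> {}" "I \<subseteq> V - {i}"
      \<comment> \<open>\<open>?J\<close> is the preimage of \<open>I\<close> under
        \<open>r\<close>. It contains both ends of \<open>e\<close> or neither, so the bound given
        for \<open>insert e E\<close> is the one for \<open>E\<close>.\<close>
      let ?J = "if j \<in> I then insert i I else I"
      have J: "?J \<noteq> {}" "?J \<subseteq> V" using I ij by auto
      have r: "r v \<in> I \<longleftrightarrow> v \<in> ?J" for v using I by (auto simp: r_def)
      have eJ: "(s e \<in> ?J) = (t e \<in> ?J)" using I by (auto simp: i_def[symmetric] j_def[symmetric])
      have "cut_edges (r \<circ> s) (r \<circ> t) E I = cut_edges s t E ?J"
        unfolding cut_edges_def o_def r ..
      hence z: "(fdiff ?J ^^ (card (cut_edges (r \<circ> s) (r \<circ> t) E I) + 1)) f = (\<lambda>_. 0)"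
        using insert.prems(5)[OF J] unfolding card_cut_edges_insert[OF insert.hyps]
        by (simp only: eJ simp_thms if_True add_0_right)
      have "i \<notin> I" using I by blast
      from fdiff_pow_contract[OF ij(3) this] show "(fdiff I ^^ (card (cut_edges (r \<circ> s) (r \<circ> t) E I) + 1))
          (\<lambda>a. f (a(i := a j))) = (\<lambda>_. 0)"
        by (rule trans) (simp only: z)
    qed
    then obtain c where c: "\<And>a. f (a(i := a j)) =
        (\<Sum>S\<in>Pow E. c S * (\<Prod>d\<in>S. edge_form s t d (a(i := a j))))"
      unfolding form_r by blast
    \<comment> \<open>The coefficients found on \<open>a i = a j\<close> are reused with the
      original edge forms. Then \<open>f - g\<close> vanishes on that hyperplane and still satisfies
      the conditions for \<open>insert e E\<close>.\<close>
    define g where "g = (\<lambda>a. \<Sum>S\<in>Pow E. c S * (\<Prod>d\<in>S. edge_form s t d a))"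
    have gV: "g \<in> polyfun V"
      unfolding g_def using insert.prems(2,3)
      by (intro polyfun_sum polyfun_smult polyfun_edge_prod) blast+
    have g0: "(fdiff I ^^ (card (cut_edges s t (insert e E) I) + 1)) g = (\<lambda>_. 0)" for I
    proof -
      have "(fdiff I ^^ (card (cut_edges s t (insert e E) I) + 1))
          (\<lambda>a. c S * (\<Prod>d\<in>S. edge_form s t d a)) = (\<lambda>_. 0)" if "S \<in> Pow E" for S
      proof -
        have "(fdiff I ^^ (card (cut_edges s t (insert e E) I) + 1))
          (\<lambda>a. \<Prod>d\<in>S. edge_form s t d a :: 'k) = (\<lambda>_. 0)"
          using that insert.hyps by (intro fdiff_pow_edge_prod_subset) auto
        thus ?thesis by (subst fdiff_pow_mult_const) simp_all
      qed
      thus ?thesis unfolding g_def fdiff_pow_sum by simp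
    qed
    have fgV: "(\<lambda>a. f a - g a) \<in> polyfun V" by (rule polyfun_diff[OF insert.prems(4) gV])
    obtain h where h: "h \<in> polyfun V"
      "\<And>a. (f a - g a) - (f (a(i := a j)) - g (a(i := a j))) = (of_nat (a i) - of_nat (a j)) * h a"
      using polyfun_divide_diff[OF fgV ij] by blast
    have fg: "f a - g a = edge_form s t e a * h a" for a
      using h(2)[of a] c[of a] by (simp add: g_def edge_form_def i_def j_def)
    have "\<exists>c. \<forall>a. h a = (\<Sum>S\<in>Pow E. c S * (\<Prod>d\<in>S. edge_form s t d a))"
    proof (rule insert.IH[OF insert.prems(1) _ _ h(1)])
      fix I assume I: "I \<noteq> {}" "I \<subseteq> V"
      have "(fdiff I ^^ (card (cut_edges s t (insert e E) I) + 1)) (\<lambda>a. f a - g a) = (\<lambda>_. 0)"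
        unfolding fdiff_pow_diff insert.prems(5)[OF I] g0 by simp
      thus "(fdiff I ^^ (card (cut_edges s t E I) + 1)) h = (\<lambda>_. 0)"
        unfolding card_cut_edges_insert[OF insert.hyps] fg
        by (rule fdiff_pow_divide_edge_form[where s = s and t = t and e = e, OF h(1) False])
    qed (use insert.prems in auto)
    then obtain c' where c': "\<And>a. h a = (\<Sum>S\<in>Pow E. c' S * (\<Prod>d\<in>S. edge_form s t d a))" by blast
    show ?thesis
    proof (intro exI allI)
      fix a
      \<comment> \<open>Inserting \<open>e\<close> into \<open>S\<close> multiplies the product by
        the form of \<open>e\<close>. Hence \<open>h\<close> supplies the coefficients of the sets
        containing \<open>e\<close>, and \<open>g\<close> those of the others.\<close>
      have "(\<Sum>S\<in>insert e ` Pow E. c' (S - {e}) * (\<Prod>d\<in>S. edge_form s t d a)) =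
          (\<Sum>S\<in>Pow E. edge_form s t e a * (c' S * (\<Prod>d\<in>S. edge_form s t d a)))"
      proof (subst sum.reindex)
        show "inj_on (insert e) (Pow E)" using insert.hyps by (auto simp: inj_on_def)
        show "sum ((\<lambda>S. c' (S - {e}) * (\<Prod>d\<in>S. edge_form s t d a)) \<circ> insert e) (Pow E) =
          (\<Sum>S\<in>Pow E. edge_form s t e a * (c' S * (\<Prod>d\<in>S. edge_form s t d a)))"
        proof (rule sum.cong[OF refl])
          fix S assume "S \<in> Pow E"
          hence "e \<notin> S" "finite S" using insert.hyps finite_subset by auto
          thus "((\<lambda>S. c' (S - {e}) * (\<Prod>d\<in>S. edge_form s t d a)) \<circ> insert e) S =
            edge_form s t e a * (c' S * (\<Prod>d\<in>S. edge_form s t d a))"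
            by simp
        qed
      qed
      also have "\<dots> = edge_form s t e a * h a" by (simp add: c' sum_distrib_left)
      finally have "f a = g a +
          (\<Sum>S\<in>insert e ` Pow E. c' (S - {e}) * (\<Prod>d\<in>S. edge_form s t d a))"
        using fg[of a] by (simp add: algebra_simps)
      also have "\<dots> = (\<Sum>S\<in>Pow E. (if e \<in> S then c' (S - {e}) else c S) * (\<Prod>d\<in>S. edge_form s t d a))
          + (\<Sum>S\<in>insert e ` Pow E. (if e \<in> S then c' (S - {e}) else c S) * (\<Prod>d\<in>S. edge_form s t d a))"
        unfolding g_def using insert.hyps
        by (intro arg_cong2[of _ _ _ _ "(+)"] sum.cong) auto
      also have "\<dots> = (\<Sum>S\<in>Pow (insert e E).
          (if e \<in> S then c' (S - {e}) else c S) * (\<Prod>d\<in>S. edge_form s t d a))"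
        unfolding Pow_insert using insert.hyps by (intro sum.union_disjoint[symmetric]) auto
      finally show "f a = (\<Sum>S\<in>Pow (insert e E).
          (if e \<in> S then c' (S - {e}) else c S) * (\<Prod>d\<in>S. edge_form s t d a))" .
    qed
  qed
qed

section \<open>Polynomials and their linear functionals\<close>

lemma sum_single_lookup: "(\<Sum>x\<in>Poly_Mapping.keys p. Poly_Mapping.single x (Poly_Mapping.lookup p x)) = p"
  by (rule poly_mapping_eqI)
    (auto simp: lookup_sum lookup_single when_def in_keys_iff not_in_keys_iff_lookup_eq_zero)

lemma poly_mapping_additive_induct [case_names zero single add]:
  fixes p :: "'a \<Rightarrow>\<^sub>0 'b::comm_monoid_add"
  assumes "P 0" "\<And>x c. P (Poly_Mapping.single x c)" "\<And>p q. P p \<Longrightarrow> P q \<Longrightarrow> P (p + q)"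
  shows "P p"
proof -
  have "P (\<Sum>x\<in>K. Poly_Mapping.single x (Poly_Mapping.lookup p x))" if "finite K" for K
    using that by induction (auto intro: assms)
  from this[of "Poly_Mapping.keys p"] show ?thesis by (simp add: sum_single_lookup)
qed

text \<open>The linear functional with value \<open>f a\<close> at the monomial with exponent vector \<open>a\<close>.\<close>

definition pairing :: "(('v \<Rightarrow> nat) \<Rightarrow> 'k::comm_ring_1) \<Rightarrow> ('v, 'k) mpoly \<Rightarrow> 'k"
  where "pairing f p = (\<Sum>m\<in>Poly_Mapping.keys p. Poly_Mapping.lookup p m * f (Poly_Mapping.lookup m))"

lemma pairing_add: "pairing f (p + q) = pairing f p + pairing f q"
  unfolding pairing_def by (rule setsum_keys_plus_distrib) (simp_all add: distrib_right)

lemma pairing_single: "pairing f (Poly_Mapping.single m c) = c * f (Poly_Mapping.lookup m)"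
  by (simp add: pairing_def)

lemma pairing_uminus: "pairing f (- p) = - pairing f p"
  by (simp add: pairing_def sum_negf)

lemma pairing_diff: "pairing f (p - q) = pairing f p - pairing f q"
  using pairing_add[of f p "- q"] by (simp add: pairing_uminus)

text \<open>Exponent vectors range over all functions, which need not have finite support; cutting
  down to a finite \<open>V\<close> makes monomials of them.\<close>

definition mono_of :: "'v set \<Rightarrow> ('v \<Rightarrow> nat) \<Rightarrow> 'v \<Rightarrow>\<^sub>0 nat"
  where "mono_of V a = (\<Sum>i\<in>V. Poly_Mapping.single i (a i))"

lemma lookup_mono_of: "finite V \<Longrightarrow> Poly_Mapping.lookup (mono_of V a) i = (if i \<in> V then a i else 0)"
  by (simp add: mono_of_def lookup_sum lookup_single when_def)

lemma mono_of_lookup: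
  "finite V \<Longrightarrow> Poly_Mapping.keys m \<subseteq> V \<Longrightarrow> mono_of V (Poly_Mapping.lookup m) = m"
  by (rule poly_mapping_eqI) (auto simp: lookup_mono_of in_keys_iff)

lemma prod_Var: "(\<Prod>i\<in>I. Var i) = Poly_Mapping.single (\<Sum>i\<in>I. Poly_Mapping.single i 1) 1"
  by (induction I rule: infinite_finite_induct) (simp_all add: Var_def mult_single)

text \<open>Multiplication by the product of the variables in \<open>I\<close> shifts the exponent
  vector along \<open>I\<close>, so multiplication by that product minus one is dual to
  \<open>fdiff I\<close>.\<close>

lemma fdiff_pow_functional:
  assumes g: "\<And>p q. g (p - q) = g p - g q" and V: "finite V" "I \<subseteq> V"
  shows "(fdiff I ^^ k) (\<lambda>a. g (Poly_Mapping.single (mono_of V a) 1)) a =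
    g (Poly_Mapping.single (mono_of V a) 1 * ((\<Prod>i\<in>I. Var i) - 1) ^ k)"
proof (induction k arbitrary: a)
  case (Suc k)
  have "finite I" using V finite_subset by blast
  hence "mono_of V (shift I a) = mono_of V a + (\<Sum>i\<in>I. Poly_Mapping.single i 1)"
    using V by (intro poly_mapping_eqI)
      (auto simp: lookup_mono_of lookup_add lookup_sum lookup_single when_def shift_def)
  hence *: "Poly_Mapping.single (mono_of V (shift I a)) 1 - Poly_Mapping.single (mono_of V a) 1 =
      Poly_Mapping.single (mono_of V a) 1 * ((\<Prod>i\<in>I. Var i) - 1)"
    by (simp add: prod_Var right_diff_distrib mult_single)
  have "g (Poly_Mapping.single (mono_of V a) 1 * ((\<Prod>i\<in>I. Var i) - 1) ^ Suc k) =
      g (Poly_Mapping.single (mono_of V (shift I a)) 1 * ((\<Prod>i\<in>I. Var i) - 1) ^ k) -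
      g (Poly_Mapping.single (mono_of V a) 1 * ((\<Prod>i\<in>I. Var i) - 1) ^ k)"
    unfolding power_Suc mult.assoc[symmetric] unfolding *[symmetric] unfolding left_diff_distrib g ..
  thus ?case
    by (simp add: fdiff_def[of I "(fdiff I ^^ k) _"] Suc.IH)
qed simp

section \<open>The relations \<open>\<phi>\<^sub>e\<^sup>2 = 0\<close>\<close>

text \<open>Membership in \<open>Phi_ideal\<close> without the restriction on the variables.\<close>

definition phi_null :: "('e, 'k::comm_ring_1) mpoly \<Rightarrow> bool"
  where "phi_null q \<longleftrightarrow> (\<forall>m\<in>Poly_Mapping.keys q. \<exists>e. 2 \<le> Poly_Mapping.lookup m e)"

lemma phi_null_zero: "phi_null 0"
  by (simp add: phi_null_def)

lemma phi_null_add: "phi_null p \<Longrightarrow> phi_null q \<Longrightarrow> phi_null (p + q)"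
  using keys_add[of p q] unfolding phi_null_def by blast

lemma phi_null_uminus: "phi_null p \<Longrightarrow> phi_null (- p)"
  unfolding phi_null_def by simp

lemma phi_null_mult: "phi_null p \<Longrightarrow> phi_null (q * p)"
  unfolding phi_null_def
proof
  fix m assume p: "\<forall>m\<in>Poly_Mapping.keys p. \<exists>e. 2 \<le> Poly_Mapping.lookup m e"
    and "m \<in> Poly_Mapping.keys (q * p)"
  then obtain a b where "m = a + b" "b \<in> Poly_Mapping.keys p" using keys_mult[of q p] by blast
  with p show "\<exists>e. 2 \<le> Poly_Mapping.lookup m e" by (metis lookup_add trans_le_add2)
qed

lemma phi_null_Var_square: "phi_null (Var e ^ 2)"
  by (auto simp: phi_null_def Var_def power2_eq_square mult_single lookup_add intro!: exI[of _ e])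

lemma phi_null_mult_cong:
  assumes "phi_null (p - p')" "phi_null (q - q')"
  shows "phi_null (p * q - p' * q')"
proof -
  have "p * q - p' * q' = q * (p - p') + p' * (q - q')" by (simp add: algebra_simps)
  thus ?thesis using assms by (metis phi_null_add phi_null_mult)
qed

lemma phi_null_prod_cong:
  assumes "\<And>e. e \<in> E \<Longrightarrow> phi_null (f e - g e)"
  shows "phi_null ((\<Prod>e\<in>E. f e) - (\<Prod>e\<in>E. g e))"
  using assms
  by (induction E rule: infinite_finite_induct) (simp_all add: phi_null_zero phi_null_mult_cong)

section \<open>Computations inside polynomial algebras\<close>

lemma Const_simps:
  "Const 0 = 0" "Const 1 = 1" "Const (c + d) = Const c + Const d" "Const (c * d) = Const c * Const d"
  by (simp_all add: Const_def single_add mult_single)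

lemma Const_prod: "Const (\<Prod>x\<in>A. f x) = (\<Prod>x\<in>A. Const (f x))"
  by (induction A rule: infinite_finite_induct) (simp_all add: Const_simps)

lemma Const_mult_single: "Const c * Poly_Mapping.single m d = Poly_Mapping.single m (c * d)"
  by (simp add: Const_def mult_single)

lemma mpoly_alg_simps:
  "monoid.mult (mpoly_alg V) = (*)" "one (mpoly_alg V) = 1" "ring.zero (mpoly_alg V) = 0"
  "add (mpoly_alg V) = (+)" "module.smult (mpoly_alg V) = (\<lambda>c p. Const c * p)"
  by (simp_all add: mpoly_alg_def)

lemma mem_carrier_mpoly_alg:
  "p \<in> carrier (mpoly_alg V) \<longleftrightarrow> (\<forall>m\<in>Poly_Mapping.keys p. Poly_Mapping.keys m \<subseteq> V)"
  by (simp add: mpoly_alg_def)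

lemma mpoly_alg_closed:
  fixes p q :: "('x, 'k::comm_ring_1) mpoly"
  assumes "p \<in> carrier (mpoly_alg V)" "q \<in> carrier (mpoly_alg V)"
  shows "p + q \<in> carrier (mpoly_alg V)" "p * q \<in> carrier (mpoly_alg V)"
    "p - q \<in> carrier (mpoly_alg V)"
proof -
  interpret cring "mpoly_alg V :: ('k, ('x, 'k) mpoly) module" by (rule mpoly_alg_cring)
  show "p + q \<in> carrier (mpoly_alg V)" "p * q \<in> carrier (mpoly_alg V)"
    using a_closed[OF assms] m_closed[OF assms] by (simp_all add: mpoly_alg_simps)
  show "p - q \<in> carrier (mpoly_alg V)"
    using assms keys_diff[of p q] by (auto simp: mem_carrier_mpoly_alg)
qed

lemma mpoly_alg_uminus_closed: "p \<in> carrier (mpoly_alg V) \<Longrightarrow> - p \<in> carrier (mpoly_alg V)"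
  by (simp add: mem_carrier_mpoly_alg)

lemma mpoly_alg_const_closed:
  "0 \<in> carrier (mpoly_alg V)" "1 \<in> carrier (mpoly_alg V)" "Const c \<in> carrier (mpoly_alg V)"
  by (auto simp: mem_carrier_mpoly_alg Const_def)

lemma mpoly_alg_sum_closed:
  "(\<And>x. x \<in> A \<Longrightarrow> f x \<in> carrier (mpoly_alg V)) \<Longrightarrow> (\<Sum>x\<in>A. f x) \<in> carrier (mpoly_alg V)"
  by (induction A rule: infinite_finite_induct) (simp_all add: mpoly_alg_closed mpoly_alg_const_closed)

lemma mpoly_alg_prod_closed:
  "(\<And>x. x \<in> A \<Longrightarrow> f x \<in> carrier (mpoly_alg V)) \<Longrightarrow> (\<Prod>x\<in>A. f x) \<in> carrier (mpoly_alg V)"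
  by (induction A rule: infinite_finite_induct) (simp_all add: mpoly_alg_closed mpoly_alg_const_closed)

lemma mpoly_alg_a_inv:
  fixes p :: "('x, 'k::comm_ring_1) mpoly"
  assumes "p \<in> carrier (mpoly_alg V)"
  shows "\<ominus>\<^bsub>mpoly_alg V\<^esub> p = - p"
proof -
  interpret cring "mpoly_alg V :: ('k, ('x, 'k) mpoly) module" by (rule mpoly_alg_cring)
  show ?thesis
    using assms by (intro minus_equality) (simp_all add: mpoly_alg_simps mpoly_alg_uminus_closed)
qed

text \<open>The ideal is monomial: the right-hand side is an ideal containing the generators, and
  conversely each monomial of one of its members is a multiple of a generator.\<close>

lemma Phi_ideal_eq:
  "Phi_ideal E = {q \<in> carrier (mpoly_alg E :: ('k::field, ('e, 'k) mpoly) module). phi_null q}"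
proof
  let ?R = "mpoly_alg E :: ('k, ('e, 'k) mpoly) module"
  let ?N = "{q \<in> carrier ?R. phi_null q}"
  interpret cring ?R by (rule mpoly_alg_cring)
  interpret I: ideal "Phi_ideal E" ?R by (rule Phi_ideal_ideal)
  have "ideal ?N ?R"
  proof (rule idealI)
    show "subgroup ?N (add_monoid ?R)"
    proof (rule add.subgroupI)
      show "?N \<subseteq> carrier ?R" by blast
      show "?N \<noteq> {}" using mpoly_alg_const_closed(1) phi_null_zero by blast
      show "\<ominus>\<^bsub>?R\<^esub> a \<in> ?N" if "a \<in> ?N" for a
        using that by (simp add: mpoly_alg_a_inv phi_null_uminus mpoly_alg_uminus_closed)
      show "a \<oplus>\<^bsub>?R\<^esub> b \<in> ?N" if "a \<in> ?N" "b \<in> ?N" for a b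
        using that by (simp add: mpoly_alg_simps mpoly_alg_closed phi_null_add)
    qed
    show "x \<otimes>\<^bsub>?R\<^esub> a \<in> ?N" if "a \<in> ?N" "x \<in> carrier ?R" for a x
      using that by (simp add: mpoly_alg_simps mpoly_alg_closed phi_null_mult)
    thus "a \<otimes>\<^bsub>?R\<^esub> x \<in> ?N" if "a \<in> ?N" "x \<in> carrier ?R" for a x
      using that by (simp add: mpoly_alg_simps mult.commute)
  qed (rule ring_axioms)
  moreover have "{Var e ^ 2 | e. e \<in> E} \<subseteq> ?N"
    by (auto simp: phi_null_Var_square intro: mpoly_alg_pow_carrier Var_carrier)
  ultimately show "Phi_ideal E \<subseteq> ?N" unfolding Phi_ideal_def by (rule genideal_minimal)
  show "?N \<subseteq> Phi_ideal E"
  proof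
    fix q assume q: "q \<in> ?N"
    have mono: "Poly_Mapping.single m (Poly_Mapping.lookup q m) \<in> Phi_ideal E"
      if m: "m \<in> Poly_Mapping.keys q" for m
    proof -
      obtain e where e: "2 \<le> Poly_Mapping.lookup m e" using q m by (auto simp: phi_null_def)
      have mE: "Poly_Mapping.keys m \<subseteq> E" using q m by (auto simp: mem_carrier_mpoly_alg)
      have "e \<in> Poly_Mapping.keys m" using e by (simp add: in_keys_iff)
      hence eE: "e \<in> E" using mE by blast
      \<comment> \<open>The cofactor of \<open>Var e ^ 2\<close>; the truncated subtraction is exact
        since the exponent at \<open>e\<close> is at least two.\<close>
      let ?r = "Poly_Mapping.single (m - Poly_Mapping.single e 2) (Poly_Mapping.lookup q m)"
      have "m - Poly_Mapping.single e 2 + Poly_Mapping.single e 2 = m"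
        using e by (intro poly_mapping_eqI) (auto simp: lookup_add lookup_minus lookup_single when_def)
      moreover have "Poly_Mapping.single e (2::nat) = Poly_Mapping.single e 1 + Poly_Mapping.single e 1"
        by (metis one_add_one single_add)
      ultimately have "Poly_Mapping.single m (Poly_Mapping.lookup q m) = ?r * Var e ^ 2"
        by (simp add: Var_def power2_eq_square mult_single)
      moreover have "Poly_Mapping.keys (m - Poly_Mapping.single e 2) \<subseteq> E"
        using mE by (auto simp: in_keys_iff lookup_minus)
      hence "?r \<in> carrier ?R" by (auto simp: mem_carrier_mpoly_alg)
      moreover have "(Var e ^ 2 :: ('e, 'k) mpoly) \<in> Phi_ideal E"
        unfolding Phi_ideal_def using eE
        by (intro genideal_self[THEN subsetD]) (auto intro: mpoly_alg_pow_carrier Var_carrier)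
      ultimately show ?thesis using I.I_l_closed[of "Var e ^ 2" ?r] by (simp add: mpoly_alg_simps)
    qed
    have "(\<Sum>m\<in>K. Poly_Mapping.single m (Poly_Mapping.lookup q m)) \<in> Phi_ideal E"
      if "finite K" "K \<subseteq> Poly_Mapping.keys q" for K
      using that
    proof induction
      case empty
      show ?case using I.zero_closed by (simp add: mpoly_alg_simps)
    next
      case (insert m K)
      thus ?case using I.a_closed mono by (simp add: mpoly_alg_simps)
    qed
    from this[of "Poly_Mapping.keys q"] show "q \<in> Phi_ideal E" by (simp add: sum_single_lookup)
  qed
qed

text \<open>
  The image of a monomial is given directly by its square-free representative, so that
  \<open>exp_subst\<close> is linear, but multiplicative only modulo \<open>phi_null\<close>.
\<close>

definition exp_poly :: "('e \<Rightarrow> 'v) \<Rightarrow> ('e \<Rightarrow> 'v) \<Rightarrow> 'e set \<Rightarrow> ('v \<Rightarrow> nat) \<Rightarrow> ('e, 'k::comm_ring_1) mpoly"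
  where "exp_poly s t E a = (\<Prod>e\<in>E. 1 + Const (edge_form s t e a) * Var e)"

definition exp_subst :: "('e \<Rightarrow> 'v) \<Rightarrow> ('e \<Rightarrow> 'v) \<Rightarrow> 'e set \<Rightarrow> ('v, 'k) mpoly \<Rightarrow> ('e, 'k::comm_ring_1) mpoly"
  where "exp_subst s t E p = (\<Sum>m\<in>Poly_Mapping.keys p.
    Const (Poly_Mapping.lookup p m) * exp_poly s t E (Poly_Mapping.lookup m))"

lemma exp_subst_add: "exp_subst s t E (p + q) = exp_subst s t E p + exp_subst s t E q"
  unfolding exp_subst_def by (rule setsum_keys_plus_distrib) (simp_all add: Const_simps distrib_right)

lemma exp_subst_zero: "exp_subst s t E 0 = 0"
  by (simp add: exp_subst_def)

lemma exp_subst_single: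
  "exp_subst s t E (Poly_Mapping.single m c) = Const c * exp_poly s t E (Poly_Mapping.lookup m)"
  by (simp add: exp_subst_def Const_simps)

lemma exp_poly_zero: "exp_poly s t E (\<lambda>_. 0) = 1"
  by (simp add: exp_poly_def edge_form_def Const_simps)

lemma exp_subst_one: "exp_subst s t E 1 = 1"
  using exp_subst_single[of s t E 0 1] by (simp add: exp_poly_zero Const_simps zero_poly_mapping.rep_eq)

lemma edge_form_add:
  "edge_form s t e (\<lambda>i. a i + b i) = edge_form s t e a + edge_form s t e b"
  by (simp add: edge_form_def)

text \<open>Exponential law, edge by edge: \<open>1 + (x + y) * z\<close> and
  \<open>(1 + x * z) * (1 + y * z)\<close> differ by a multiple of \<open>z ^ 2\<close>.\<close>

lemma exp_poly_add:
  "phi_null (exp_poly s t E (\<lambda>i. a i + b i) - (exp_poly s t E a * exp_poly s t E b :: ('e, 'k::comm_ring_1) mpoly))"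
  unfolding exp_poly_def prod.distrib[symmetric]
proof (rule phi_null_prod_cong)
  fix e
  have "(1 + Const (edge_form s t e (\<lambda>i. a i + b i) :: 'k) * Var e)
      - (1 + Const (edge_form s t e a) * Var e) * (1 + Const (edge_form s t e b) * Var e) =
      - Const (edge_form s t e a * edge_form s t e b) * Var e ^ 2"
    by (simp add: edge_form_add Const_simps algebra_simps power2_eq_square)
  thus "phi_null ((1 + Const (edge_form s t e (\<lambda>i. a i + b i) :: 'k) * Var e)
      - (1 + Const (edge_form s t e a) * Var e) * (1 + Const (edge_form s t e b) * Var e))"
    by (simp only: phi_null_mult phi_null_Var_square)
qed

text \<open>Additivity in \<open>p\<close> and in \<open>q\<close> reduces this to monomials, where
  it is the exponential law.\<close>

lemma exp_subst_mult: "phi_null (exp_subst s t E (p * q) - exp_subst s t E p * exp_subst s t E q)"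
proof (induction p rule: poly_mapping_additive_induct)
  case (single m c)
  show ?case
  proof (induction q rule: poly_mapping_additive_induct)
    case (single m' d)
    have "exp_subst s t E (Poly_Mapping.single m c * Poly_Mapping.single m' d)
        - exp_subst s t E (Poly_Mapping.single m c) * exp_subst s t E (Poly_Mapping.single m' d) =
        Const (c * d) * (exp_poly s t E (\<lambda>i. Poly_Mapping.lookup m i + Poly_Mapping.lookup m' i)
          - exp_poly s t E (Poly_Mapping.lookup m) * exp_poly s t E (Poly_Mapping.lookup m'))"
      by (simp add: mult_single exp_subst_single lookup_add Const_simps algebra_simps plus_poly_mapping.rep_eq)
    thus ?case by (simp only: phi_null_mult exp_poly_add)
  next
    case (add p q)
    from phi_null_add[OF add.IH] show ?case by (simp add: exp_subst_add algebra_simps)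
  qed (simp add: exp_subst_zero phi_null_zero)
next
  case (add p' p)
  from phi_null_add[OF add.IH] show ?case by (simp add: exp_subst_add algebra_simps)
qed (simp add: exp_subst_zero phi_null_zero)

lemma exp_subst_smult: "exp_subst s t E (Const c * p) = Const c * exp_subst s t E p"
  by (induction p rule: poly_mapping_additive_induct)
    (simp_all add: exp_subst_zero exp_subst_add exp_subst_single Const_mult_single Const_simps
      distrib_left mult.assoc)

lemma exp_poly_closed: "exp_poly s t E a \<in> carrier (mpoly_alg E)"
  unfolding exp_poly_def
  by (intro mpoly_alg_prod_closed mpoly_alg_closed mpoly_alg_const_closed Var_carrier)

lemma exp_subst_closed: "exp_subst s t E p \<in> carrier (mpoly_alg E)"
  unfolding exp_subst_def
  by (intro mpoly_alg_sum_closed mpoly_alg_closed mpoly_alg_const_closed exp_poly_closed)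

lemma exp_poly_expand:
  assumes "finite E"
  shows "exp_poly s t E a =
    (\<Sum>S\<in>Pow E. Poly_Mapping.single (\<Sum>e\<in>S. Poly_Mapping.single e 1) (\<Prod>e\<in>S. edge_form s t e a))"
proof -
  have "exp_poly s t E a = (\<Prod>e\<in>E. Const (edge_form s t e a) * Var e + 1)"
    by (simp add: exp_poly_def add.commute)
  also have "\<dots> = (\<Sum>S\<in>Pow E. (\<Prod>e\<in>S. Const (edge_form s t e a) * Var e))"
    by (simp add: prod_add[OF assms])
  also have "\<dots> = (\<Sum>S\<in>Pow E. Poly_Mapping.single (\<Sum>e\<in>S. Poly_Mapping.single e 1) (\<Prod>e\<in>S. edge_form s t e a))"
  proof (rule sum.cong[OF refl])
    fix S
    show "(\<Prod>e\<in>S. Const (edge_form s t e a) * Var e) =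
        Poly_Mapping.single (\<Sum>e\<in>S. Poly_Mapping.single e 1) (\<Prod>e\<in>S. edge_form s t e a)"
      by (simp add: prod.distrib prod_Var Const_mult_single Const_prod[symmetric])
  qed
  finally show ?thesis .
qed

lemma exp_subst_expand:
  assumes "finite E"
  shows "exp_subst s t E p = (\<Sum>S\<in>Pow E. Poly_Mapping.single (\<Sum>e\<in>S. Poly_Mapping.single e 1)
    (pairing (\<lambda>a. \<Prod>e\<in>S. edge_form s t e a) p))"
proof (induction p rule: poly_mapping_additive_induct)
  case zero
  show ?case by (simp add: exp_subst_zero pairing_def)
next
  case (single m c)
  show ?case
    by (simp add: exp_subst_single exp_poly_expand[OF assms] pairing_single sum_distrib_left Const_mult_single)
next
  case (add p q)
  thus ?case by (simp add: exp_subst_add pairing_add single_add sum.distrib)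
qed

text \<open>Different \<open>S\<close> give different square-free monomials, none of which occurs in
  a \<open>phi_null\<close> polynomial, so the coefficients must vanish one by one.\<close>

lemma phi_null_exp_subst_iff:
  assumes "finite E"
  shows "phi_null (exp_subst s t E p) \<longleftrightarrow>
    (\<forall>S\<subseteq>E. pairing (\<lambda>a. \<Prod>e\<in>S. edge_form s t e a) p = 0)"
proof
  assume "\<forall>S\<subseteq>E. pairing (\<lambda>a. \<Prod>e\<in>S. edge_form s t e a) p = 0"
  hence "exp_subst s t E p = 0" unfolding exp_subst_expand[OF assms] by (intro sum.neutral) auto
  thus "phi_null (exp_subst s t E p)" by (simp add: phi_null_zero)
next
  assume null: "phi_null (exp_subst s t E p)"
  show "\<forall>S\<subseteq>E. pairing (\<lambda>a. \<Prod>e\<in>S. edge_form s t e a) p = 0"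
  proof (intro allI impI)
    fix S assume S: "S \<subseteq> E"
    let ?m = "\<lambda>S. \<Sum>e\<in>S. Poly_Mapping.single e (1::nat)"
    have lm: "Poly_Mapping.lookup (?m T) e = (if e \<in> T then 1 else 0)" if "T \<subseteq> E" for T e
      using finite_subset[OF that assms] by (simp add: lookup_sum lookup_single when_def)
    have eq: "?m T = ?m S \<longleftrightarrow> T = S" if T: "T \<subseteq> E" for T
    proof
      assume "?m T = ?m S"
      hence "e \<in> T \<longleftrightarrow> e \<in> S" for e
        using lm[OF T, of e] lm[OF S, of e] by (metis zero_neq_one)
      thus "T = S" by blast
    qed simp
    have "Poly_Mapping.lookup (exp_subst s t E p) (?m S) =
        (\<Sum>T\<in>Pow E. if T = S then pairing (\<lambda>a. \<Prod>e\<in>T. edge_form s t e a) p else 0)"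
      unfolding exp_subst_expand[OF assms] lookup_sum lookup_single when_def
      by (intro sum.cong refl) (simp only: Pow_iff eq)
    also have "\<dots> = pairing (\<lambda>a. \<Prod>e\<in>S. edge_form s t e a) p"
      using assms S by simp
    finally have "Poly_Mapping.lookup (exp_subst s t E p) (?m S) =
        pairing (\<lambda>a. \<Prod>e\<in>S. edge_form s t e a) p" .
    moreover have "?m S \<notin> Poly_Mapping.keys (exp_subst s t E p)"
    proof
      assume "?m S \<in> Poly_Mapping.keys (exp_subst s t E p)"
      then obtain e where "2 \<le> Poly_Mapping.lookup (?m S) e"
        using null unfolding phi_null_def by blast
      moreover have "Poly_Mapping.lookup (?m S) e \<le> 1" unfolding lm[OF S] by simp
      ultimately show False by linarith
    qed
    ultimately show "pairing (\<lambda>a. \<Prod>e\<in>S. edge_form s t e a) p = 0"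
      by (simp add: in_keys_iff)
  qed
qed

text \<open>A basis of \<open>U\<close> stays independent when \<open>p\<close> is added, so a
  linear functional can be prescribed as 0 on the basis and 1 at \<open>p\<close>. Membership in an
  ideal can thus be tested by functionals.\<close>

lemma mpoly_separating_functional:
  fixes U :: "('x, 'k::field) mpoly set"
  assumes U: "0 \<in> U" "\<And>p q. p \<in> U \<Longrightarrow> q \<in> U \<Longrightarrow> p + q \<in> U"
    "\<And>c p. p \<in> U \<Longrightarrow> Const c * p \<in> U" and p: "p \<notin> U"
  shows "\<exists>g :: ('x, 'k) mpoly \<Rightarrow> 'k. (\<forall>p q. g (p + q) = g p + g q) \<and>
    (\<forall>c p. g (Const c * p) = c * g p) \<and> (\<forall>q\<in>U. g q = 0) \<and> g p \<noteq> 0"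
proof -
  interpret vector_space_pair "\<lambda>c (p :: ('x, 'k) mpoly). Const c * p" "(*) :: 'k \<Rightarrow> _"
    by unfold_locales (simp_all add: Const_simps algebra_simps)
  have sub: "vs1.subspace U" using U by (auto simp: vs1.subspace_def)
  obtain B where B: "B \<subseteq> U" "vs1.independent B" "U \<subseteq> vs1.span B"
    using vs1.maximal_independent_subset[of U] by blast
  have sB: "vs1.span B = U" using B vs1.span_minimal[OF B(1) sub] by blast
  have "vs1.independent (insert p B)" using p B by (intro vs1.independent_insertI) (simp_all add: sB)
  from linear_independent_extend[OF this, of "\<lambda>x. if x = p then 1 else 0"]
  obtain g where g: "Vector_Spaces.linear (\<lambda>c p. Const c * p) (*) g"
    "\<forall>x\<in>insert p B. g x = (if x = p then 1 else 0)" by blast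
  have "g x = 0" if "x \<in> B" for x using g(2) that B p by auto
  hence "g q = 0" if "q \<in> U" for q
    using linear_eq_0_on_span[OF g(1), of B q] that sB by blast
  moreover have "g p \<noteq> 0" using g(2) by simp
  ultimately show ?thesis
    by (intro exI[of _ g] conjI allI ballI) (rule linear_add[OF g(1)] linear_scale[OF g(1)] | assumption)+
qed

section \<open>The isomorphism\<close>

definition src :: "('e \<Rightarrow> nat set) \<Rightarrow> 'e \<Rightarrow> nat"
  where "src ends e = Min (ends e)"

definition tgt :: "('e \<Rightarrow> nat set) \<Rightarrow> 'e \<Rightarrow> nat"
  where "tgt ends e = Max (ends e)"

lemma ends_eq_src_tgt:
  assumes "loopless_multigraph n E ends" "e \<in> E"
  shows "ends e = {src ends e, tgt ends e}" "src ends e < tgt ends e"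
    "src ends e \<in> {0..n}" "tgt ends e \<in> {0..n}"
proof -
  have e: "ends e \<subseteq> {0..n}" "card (ends e) = 2"
    using assms by (auto simp: loopless_multigraph_def)
  obtain i j where "ends e = {i, j}" "i \<noteq> j" using e(2) card_2_iff by metis
  moreover define a b where "a = min i j" and "b = max i j"
  ultimately have ab: "ends e = {a, b}" "a < b" by (auto simp: min_def max_def)
  have "src ends e = a" "tgt ends e = b" using ab by (auto simp: src_def tgt_def)
  thus "ends e = {src ends e, tgt ends e}" "src ends e < tgt ends e"
    "src ends e \<in> {0..n}" "tgt ends e \<in> {0..n}"
    using ab e by auto
qed

text \<open>Edges run from the smaller to the larger end point, which matches the sign convention;
  evaluating at a unit vector makes \<open>Y_gen\<close> the image of a variable.\<close>

lemma inc_sign_eq_edge_form: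
  assumes "loopless_multigraph n E ends" "e \<in> E"
  shows "inc_sign ends i e =
    (edge_form (src ends) (tgt ends) e (Poly_Mapping.lookup (Poly_Mapping.single i 1)) :: 'k::comm_ring_1)"
proof -
  note e = ends_eq_src_tgt[OF assms]
  have "(\<exists>j. ends e = {i, j} \<and> i < j) \<longleftrightarrow> i = src ends e"
    using e(2) unfolding e(1) by (auto simp: doubleton_eq_iff)
  moreover have "(\<exists>j. ends e = {i, j} \<and> i > j) \<longleftrightarrow> i = tgt ends e"
    using e(2) unfolding e(1) by (auto simp: doubleton_eq_iff)
  ultimately show ?thesis
    using e(2) by (auto simp: inc_sign_def edge_form_def lookup_single when_def)
qed

lemma cut_size_eq_card_cut_edges:
  assumes "loopless_multigraph n E ends"
  shows "cut_size E ends I = card (cut_edges (src ends) (tgt ends) E I)"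
proof -
  have "card (ends e \<inter> I) = 1 \<longleftrightarrow> (src ends e \<in> I) \<noteq> (tgt ends e \<in> I)" if "e \<in> E" for e
  proof -
    note e = ends_eq_src_tgt[OF assms that]
    have "ends e \<inter> I = (if src ends e \<in> I then {src ends e} else {}) \<union>
        (if tgt ends e \<in> I then {tgt ends e} else {})"
      by (subst e(1)) auto
    thus ?thesis using e(2) by auto
  qed
  thus ?thesis unfolding cut_size_def cut_edges_def by (intro arg_cong[of _ _ card]) blast
qed

section \<open>Computing in \<open>Phi_alg\<close> with coset representatives\<close>

definition Phi_coset :: "'e set \<Rightarrow> ('e, 'k::field) mpoly \<Rightarrow> ('e, 'k) mpoly set"
  where "Phi_coset E q = Phi_ideal E +>\<^bsub>mpoly_alg E\<^esub> q"

lemma Phi_coset_closed: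
  "q \<in> carrier (mpoly_alg E) \<Longrightarrow> Phi_coset E q \<in> carrier (Phi_alg E)"
  by (auto simp: Phi_coset_def Phi_alg_def quot_alg_simps FactRing_def A_RCOSETS_def')

lemma Phi_coset_add:
  fixes p q :: "('e, 'k::field) mpoly"
  assumes "p \<in> carrier (mpoly_alg E)" "q \<in> carrier (mpoly_alg E)"
  shows "Phi_coset E p \<oplus>\<^bsub>Phi_alg E\<^esub> Phi_coset E q = Phi_coset E (p + q)"
proof -
  interpret I: ideal "Phi_ideal E" "mpoly_alg E :: ('k, ('e, 'k) mpoly) module"
    by (rule Phi_ideal_ideal)
  show ?thesis using I.a_rcos_sum[OF assms]
    by (simp add: Phi_coset_def Phi_alg_def quot_alg_simps FactRing_def mpoly_alg_simps)
qed

lemma Phi_coset_mult: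
  fixes p q :: "('e, 'k::field) mpoly"
  assumes "p \<in> carrier (mpoly_alg E)" "q \<in> carrier (mpoly_alg E)"
  shows "Phi_coset E p \<otimes>\<^bsub>Phi_alg E\<^esub> Phi_coset E q = Phi_coset E (p * q)"
proof -
  interpret I: ideal "Phi_ideal E" "mpoly_alg E :: ('k, ('e, 'k) mpoly) module"
    by (rule Phi_ideal_ideal)
  show ?thesis using I.rcoset_mult_add[OF assms]
    by (simp add: Phi_coset_def Phi_alg_def quot_alg_simps FactRing_def mpoly_alg_simps)
qed

lemma Phi_coset_one: "\<one>\<^bsub>Phi_alg E\<^esub> = Phi_coset E 1"
  by (simp add: Phi_coset_def Phi_alg_def quot_alg_simps FactRing_def mpoly_alg_simps)

lemma Phi_coset_smult:
  fixes p :: "('e, 'k::field) mpoly"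
  assumes "p \<in> carrier (mpoly_alg E)"
  shows "c \<odot>\<^bsub>Phi_alg E\<^esub> Phi_coset E p = Phi_coset E (Const c * p)"
  using quot_alg_smult[OF mpoly_alg_algebra Phi_ideal_ideal _ assms, of c]
  by (simp add: Phi_coset_def Phi_alg_def mpoly_alg_simps ring_of_type_algebra_def)

lemma Phi_coset_eq_iff:
  fixes p q :: "('e, 'k::field) mpoly"
  assumes "p \<in> carrier (mpoly_alg E)" "q \<in> carrier (mpoly_alg E)"
  shows "Phi_coset E p = Phi_coset E q \<longleftrightarrow> phi_null (p - q)"
proof -
  interpret cring "mpoly_alg E :: ('k, ('e, 'k) mpoly) module" by (rule mpoly_alg_cring)
  have "p \<ominus>\<^bsub>mpoly_alg E\<^esub> q = p - q"
    using assms by (simp add: a_minus_def mpoly_alg_a_inv mpoly_alg_simps)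
  thus ?thesis
    using quotient_eq_iff_same_a_r_cos[OF Phi_ideal_ideal assms] mpoly_alg_closed(3)[OF assms]
    by (simp add: Phi_coset_def Phi_ideal_eq)
qed

lemma Phi_coset_zero: "\<zero>\<^bsub>Phi_alg E\<^esub> = Phi_coset E (0 :: ('e, 'k::field) mpoly)"
proof -
  interpret P: algebra "ring_of_type_algebra :: 'k ring" "Phi_alg E :: ('k, ('e, 'k) mpoly set) module"
    by (rule Phi_alg_algebra)
  have "Phi_coset E 0 \<oplus>\<^bsub>Phi_alg E\<^esub> Phi_coset E 0 = Phi_coset E (0 :: ('e, 'k) mpoly)"
    by (simp add: Phi_coset_add mpoly_alg_const_closed)
  thus ?thesis
    using P.add.r_cancel_one'[of "Phi_coset E 0" "Phi_coset E 0"]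
    by (simp add: Phi_coset_closed mpoly_alg_const_closed)
qed

text \<open>The homomorphism \<open>y\<^sub>i \<mapsto> Y\<^sub>i\<close> from polynomials to \<open>\<Phi>\<^sub>G\<close>.\<close>

definition psi :: "('e \<Rightarrow> nat set) \<Rightarrow> 'e set \<Rightarrow> (nat, 'k::field) mpoly \<Rightarrow> ('e, 'k) mpoly set"
  where "psi ends E p = Phi_coset E (exp_subst (src ends) (tgt ends) E p)"

lemma psi_closed: "psi ends E p \<in> carrier (Phi_alg E)"
  by (simp add: psi_def Phi_coset_closed exp_subst_closed)

lemma psi_add: "psi ends E (p + q) = psi ends E p \<oplus>\<^bsub>Phi_alg E\<^esub> psi ends E q"
  by (simp add: psi_def exp_subst_add Phi_coset_add exp_subst_closed)

lemma psi_mult: "psi ends E (p * q) = psi ends E p \<otimes>\<^bsub>Phi_alg E\<^esub> psi ends E q"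
  unfolding psi_def Phi_coset_mult[OF exp_subst_closed exp_subst_closed]
  by (simp add: Phi_coset_eq_iff mpoly_alg_closed exp_subst_closed exp_subst_mult)

lemma psi_one: "psi ends E 1 = \<one>\<^bsub>Phi_alg E\<^esub>"
  by (simp add: psi_def exp_subst_one Phi_coset_one)

lemma psi_zero: "psi ends E 0 = \<zero>\<^bsub>Phi_alg E\<^esub>"
  by (simp add: psi_def exp_subst_zero Phi_coset_zero)

lemma psi_smult: "psi ends E (Const c * p) = c \<odot>\<^bsub>Phi_alg E\<^esub> psi ends E p"
  by (simp add: psi_def exp_subst_smult Phi_coset_smult exp_subst_closed)

lemma psi_eq_zero_iff:
  "finite E \<Longrightarrow> psi ends E p = \<zero>\<^bsub>Phi_alg E\<^esub> \<longleftrightarrow>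
    (\<forall>S\<subseteq>E. pairing (\<lambda>a. \<Prod>e\<in>S. edge_form (src ends) (tgt ends) e a) p = 0)"
  by (simp add: psi_def Phi_coset_zero Phi_coset_eq_iff exp_subst_closed mpoly_alg_const_closed
      phi_null_exp_subst_iff)

lemma psi_uminus: "psi ends E (- p) = \<ominus>\<^bsub>Phi_alg E\<^esub> psi ends E (p :: (nat, 'k::field) mpoly)"
proof -
  interpret P: algebra "ring_of_type_algebra :: 'k ring" "Phi_alg E :: ('k, ('a, 'k) mpoly set) module"
    by (rule Phi_alg_algebra)
  have "psi ends E (- p) \<oplus>\<^bsub>Phi_alg E\<^esub> psi ends E p = \<zero>\<^bsub>Phi_alg E\<^esub>"
    by (simp add: psi_add[symmetric] psi_zero)
  thus ?thesis using P.M.minus_equality[of "psi ends E (- p)" "psi ends E p"] by (simp add: psi_closed)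
qed

text \<open>Each factor is the coset of a linear polynomial, so the product is the coset of a
  product of polynomials, which is \<open>exp_poly\<close> at the exponent vector of
  \<open>Var i\<close>.\<close>

lemma Y_gen_eq_psi_Var:
  assumes "loopless_multigraph n E ends"
  shows "Y_gen E ends i = psi ends E (Var i :: (nat, 'k::field) mpoly)"
proof -
  let ?P = "Phi_alg E :: ('k, ('a, 'k) mpoly set) module"
  interpret P: algebra "ring_of_type_algebra :: 'k ring" ?P by (rule Phi_alg_algebra)
  let ?y = "\<lambda>e. \<one>\<^bsub>?P\<^esub> \<oplus>\<^bsub>?P\<^esub> inc_sign ends i e \<odot>\<^bsub>?P\<^esub> phi E e"
  let ?z = "\<lambda>e. 1 + Const (inc_sign ends i e) * Var e :: ('a, 'k) mpoly"
  have z: "?z e \<in> carrier (mpoly_alg E)" if "e \<in> E" for e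
    using that by (intro mpoly_alg_closed mpoly_alg_const_closed Var_carrier)
  have y: "?y e = Phi_coset E (?z e)" if "e \<in> E" for e
    using that Var_carrier[OF that, where 'k = 'k]
    by (simp add: Phi_coset_one phi_def Phi_coset_def[symmetric] Phi_coset_smult Phi_coset_add
        mpoly_alg_closed mpoly_alg_const_closed)
  have fin: "finite E" using assms by (simp add: loopless_multigraph_def)
  have "finprod ?P ?y F = Phi_coset E (\<Prod>e\<in>F. ?z e)" if "finite F" "F \<subseteq> E" for F
    using that
  proof induction
    case empty
    show ?case by (simp add: Phi_coset_one)
  next
    case (insert e F)
    have "finprod ?P ?y (insert e F) = ?y e \<otimes>\<^bsub>?P\<^esub> finprod ?P ?y F"
      using insert by (intro P.finprod_insert) (auto simp: y Phi_coset_closed z subset_iff)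
    also have "\<dots> = Phi_coset E (?z e) \<otimes>\<^bsub>?P\<^esub> Phi_coset E (\<Prod>e\<in>F. ?z e)"
      using insert y by simp
    also have "\<dots> = Phi_coset E (\<Prod>e\<in>insert e F. ?z e)"
      using insert by (subst Phi_coset_mult) (auto intro: z mpoly_alg_prod_closed simp: subset_iff)
    finally show ?case .
  qed
  from this[OF fin] have "Y_gen E ends i = Phi_coset E (\<Prod>e\<in>E. ?z e)"
    by (simp add: Y_gen_def)
  also have "(\<Prod>e\<in>E. ?z e) = exp_subst (src ends) (tgt ends) E (Var i)"
    by (simp add: Var_def exp_subst_single Const_simps exp_poly_def inc_sign_eq_edge_form[OF assms])
  finally show ?thesis by (simp add: psi_def)
qed

lemma foldr_Y_gen_eq_psi:
  assumes "loopless_multigraph n E ends"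
  shows "foldr (\<lambda>i y. Y_gen E ends i \<otimes>\<^bsub>Phi_alg E\<^esub> y) vs \<one>\<^bsub>Phi_alg E :: ('k::field, ('e, 'k) mpoly set) module\<^esub> =
    psi ends E (Poly_Mapping.single (\<Sum>i\<leftarrow>vs. Poly_Mapping.single i 1) 1)"
proof (induction vs)
  case Nil
  show ?case by (simp add: psi_one)
next
  case (Cons i vs)
  thus ?case
    by (simp add: Y_gen_eq_psi_Var[OF assms] psi_mult[symmetric] Var_def mult_single)
qed

section \<open>Carrier and filtration of \<open>K_alg\<close> as images of polynomials\<close>

lemma monom_degree_single_add: "monom_degree (Poly_Mapping.single i 1 + m) = Suc (monom_degree m)"
proof -
  have "monom_degree (p + q) = monom_degree p + monom_degree q" for p q :: "'a \<Rightarrow>\<^sub>0 nat"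
    unfolding monom_degree_def by (rule setsum_keys_plus_distrib) simp_all
  thus ?thesis by (simp add: monom_degree_def)
qed

text \<open>Links the lists in \<open>K_filtration\<close> to monomials: listing each variable as
  often as its exponent says gives a word whose length is the degree.\<close>

lemma monomials_eq_sum_lists:
  "{m. Poly_Mapping.keys m \<subseteq> V \<and> monom_degree m \<le> k} =
    {\<Sum>i\<leftarrow>vs. Poly_Mapping.single i 1 | vs. set vs \<subseteq> V \<and> length vs \<le> k}" (is "?L = ?R")
proof
  show "?R \<subseteq> ?L"
  proof
    fix m assume "m \<in> ?R"
    then obtain vs where vs: "m = (\<Sum>i\<leftarrow>vs. Poly_Mapping.single i 1)" "set vs \<subseteq> V" "length vs \<le> k"
      by blast
    have "Poly_Mapping.keys (\<Sum>i\<leftarrow>us. Poly_Mapping.single i (1::nat)) \<subseteq> set us \<and>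
        monom_degree (\<Sum>i\<leftarrow>us. Poly_Mapping.single i 1) = length us" for us :: "'a list"
    proof (induction us)
      case Nil
      show ?case by (simp add: monom_degree_def)
    next
      case (Cons i us)
      thus ?case
        using keys_add[of "Poly_Mapping.single i (1::nat)" "\<Sum>i\<leftarrow>us. Poly_Mapping.single i 1"]
          monom_degree_single_add[of i "\<Sum>i\<leftarrow>us. Poly_Mapping.single i 1"]
        by auto
    qed
    with vs show "m \<in> ?L" by (metis (mono_tags, lifting) mem_Collect_eq subset_trans)
  qed
  show "?L \<subseteq> ?R"
  proof
    fix m assume m: "m \<in> ?L"
    have "\<exists>vs. set vs \<subseteq> K \<and> length vs = (\<Sum>i\<in>K. Poly_Mapping.lookup m i) \<and>
        (\<Sum>i\<leftarrow>vs. Poly_Mapping.single i 1) = (\<Sum>i\<in>K. Poly_Mapping.single i (Poly_Mapping.lookup m i))"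
      if "finite K" for K
      using that
    proof induction
      case empty
      show ?case by simp
    next
      case (insert i K)
      then obtain vs where vs: "set vs \<subseteq> K" "length vs = (\<Sum>i\<in>K. Poly_Mapping.lookup m i)"
        "(\<Sum>i\<leftarrow>vs. Poly_Mapping.single i 1) = (\<Sum>i\<in>K. Poly_Mapping.single i (Poly_Mapping.lookup m i))"
        by blast
      have "(\<Sum>i\<leftarrow>replicate d i. Poly_Mapping.single i (1::nat)) = Poly_Mapping.single i d" for d
        by (induction d) (simp_all flip: single_add)
      with vs insert.hyps show ?case
        by (intro exI[of _ "replicate (Poly_Mapping.lookup m i) i @ vs"]) auto
    qed
    from this[of "Poly_Mapping.keys m"] obtain vs where
      "set vs \<subseteq> Poly_Mapping.keys m" "length vs = monom_degree m"
      "(\<Sum>i\<leftarrow>vs. Poly_Mapping.single i 1) = m"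
      by (auto simp: sum_single_lookup monom_degree_def)
    with m show "m \<in> ?R" by (intro CollectI exI[of _ vs]) auto
  qed
qed

text \<open>The set \<open>M\<close> is kept general: monomials of degree at most \<open>k\<close>
  yield the filtration, all monomials in the variables yield the carrier.\<close>

lemma psi_image_submodule:
  "submodule (psi ends E ` {p. Poly_Mapping.keys p \<subseteq> M}) (ring_of_type_algebra :: 'k::field ring)
    (Phi_alg E :: ('k, ('e, 'k) mpoly set) module)" (is "submodule ?H _ ?P")
proof -
  interpret P: algebra "ring_of_type_algebra :: 'k ring" ?P by (rule Phi_alg_algebra)
  show ?thesis
  proof (rule P.submoduleI)
    show "?H \<subseteq> carrier ?P" using psi_closed by blast
    show "\<zero>\<^bsub>?P\<^esub> \<in> ?H" by (rule image_eqI[of _ _ 0]) (simp_all add: psi_zero)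
    show "\<ominus>\<^bsub>?P\<^esub> a \<in> ?H" if a: "a \<in> ?H" for a
    proof -
      obtain p where "a = psi ends E p" "Poly_Mapping.keys p \<subseteq> M" using a by blast
      thus ?thesis by (intro image_eqI[of _ _ "- p"]) (simp_all add: psi_uminus)
    qed
    show "a \<oplus>\<^bsub>?P\<^esub> b \<in> ?H" if ab: "a \<in> ?H" "b \<in> ?H" for a b
    proof -
      obtain p q where "a = psi ends E p" "Poly_Mapping.keys p \<subseteq> M"
        "b = psi ends E q" "Poly_Mapping.keys q \<subseteq> M" using ab by blast
      thus ?thesis using keys_add[of p q] by (intro image_eqI[of _ _ "p + q"]) (auto simp: psi_add)
    qed
    show "c \<odot>\<^bsub>?P\<^esub> a \<in> ?H" if a: "a \<in> ?H" for c a
    proof -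
      obtain p where "a = psi ends E p" "Poly_Mapping.keys p \<subseteq> M" using a by blast
      moreover have "Poly_Mapping.keys (Const c * p) \<subseteq> Poly_Mapping.keys p"
        using keys_mult[of "Const c" p] by (auto simp: Const_def split: if_splits)
      ultimately show ?thesis by (intro image_eqI[of _ _ "Const c * p"]) (auto simp: psi_smult)
    qed
  qed
qed

lemma psi_image_subset_submodule:
  assumes B: "submodule B (ring_of_type_algebra :: 'k::field ring)
      (Phi_alg E :: ('k, ('e, 'k) mpoly set) module)"
    and M: "\<And>m. m \<in> M \<Longrightarrow> psi ends E (Poly_Mapping.single m 1) \<in> B"
  shows "psi ends E ` {p. Poly_Mapping.keys p \<subseteq> M} \<subseteq> B"
proof
  interpret P: algebra "ring_of_type_algebra :: 'k ring" "Phi_alg E :: ('k, ('e, 'k) mpoly set) module"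
    by (rule Phi_alg_algebra)
  note B' = P.submoduleE[OF B]
  have zero: "\<zero>\<^bsub>Phi_alg E :: ('k, ('e, 'k) mpoly set) module\<^esub> \<in> B"
    using subgroup.one_closed[OF submodule.axioms(1)[OF B]] by simp
  fix x :: "('e, 'k) mpoly set" assume "x \<in> psi ends E ` {p. Poly_Mapping.keys p \<subseteq> M}"
  then obtain p where p: "x = psi ends E p" "Poly_Mapping.keys p \<subseteq> M" by blast
  have "psi ends E (\<Sum>m\<in>K. Poly_Mapping.single m (Poly_Mapping.lookup p m)) \<in> B"
    if "finite K" "K \<subseteq> M" for K
    using that
  proof induction
    case empty
    show ?case using zero by (simp add: psi_zero)
  next
    case (insert m K)
    have "psi ends E (Const (Poly_Mapping.lookup p m) * Poly_Mapping.single m 1) \<in> B"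
      unfolding psi_smult using insert M by (intro B'(4)) (auto simp: ring_of_type_algebra_def)
    thus ?case using insert B'(5) by (simp add: psi_add Const_mult_single)
  qed
  from this[of "Poly_Mapping.keys p"] p show "x \<in> B" by (simp add: sum_single_lookup)
qed

text \<open>The span of the images of monomials is the image of their span, and words of length at
  most \<open>k\<close> are the monomials of degree at most \<open>k\<close>.\<close>

lemma K_filtration_eq:
  assumes "loopless_multigraph n E ends"
  shows "(K_filtration n E ends k :: ('e, 'k::field) mpoly set set) =
    psi ends E ` {p \<in> carrier (mpoly_alg {0..n}). total_degree_le k p}"
proof -
  let ?M = "{m. Poly_Mapping.keys m \<subseteq> {0..n} \<and> monom_degree m \<le> k}"
  let ?P = "Phi_alg E :: ('k, ('e, 'k) mpoly set) module"
  let ?S = "(\<lambda>m. psi ends E (Poly_Mapping.single m 1)) ` ?M :: ('e, 'k) mpoly set set"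
  have S: "K_filtration n E ends k = lin_span ?P ?S"
    unfolding K_filtration_def foldr_Y_gen_eq_psi[OF assms] monomials_eq_sum_lists
    by (rule arg_cong[of _ _ "lin_span ?P"]) blast
  have "lin_span ?P ?S = psi ends E ` {p. Poly_Mapping.keys p \<subseteq> ?M}" (is "_ = ?H")
  proof
    have "?S \<subseteq> ?H" by auto
    thus "lin_span ?P ?S \<subseteq> ?H" unfolding lin_span_def using psi_image_submodule by blast
    show "?H \<subseteq> lin_span ?P ?S"
      unfolding lin_span_def
      by (intro Inter_greatest psi_image_subset_submodule) auto
  qed
  moreover have "{p. Poly_Mapping.keys p \<subseteq> ?M} =
      {p \<in> carrier (mpoly_alg {0..n}) :: (nat, 'k) mpoly set. total_degree_le k p}"
    by (auto simp: mem_carrier_mpoly_alg total_degree_le_def)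
  ultimately show ?thesis by (simp add: S)
qed

lemma psi_ring_hom:
  "ring_hom_ring (mpoly_alg V) (Phi_alg E :: ('k::field, ('e, 'k) mpoly set) module) (psi ends E)"
proof (rule ring_hom_ringI2)
  interpret P: algebra "ring_of_type_algebra :: 'k ring" "Phi_alg E :: ('k, ('e, 'k) mpoly set) module"
    by (rule Phi_alg_algebra)
  show "ring (Phi_alg E :: ('k, ('e, 'k) mpoly set) module)" by (rule P.ring_axioms)
  show "ring (mpoly_alg V :: ('k, (nat, 'k) mpoly) module)"
    by (rule cring.axioms(1)[OF mpoly_alg_cring])
  show "psi ends E \<in> ring_hom (mpoly_alg V) (Phi_alg E)"
    by (rule ring_hom_memI) (simp_all add: psi_closed psi_mult psi_add psi_one mpoly_alg_simps)
qed

text \<open>The image of \<open>psi\<close> is a subalgebra containing the generators; conversely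
  every such subalgebra contains all words in the \<open>Y_gen\<close>, hence their linear
  combinations.\<close>

lemma carrier_K_alg_eq:
  assumes "loopless_multigraph n E ends"
  shows "carrier (K_alg n E ends :: ('k::field, ('e, 'k) mpoly set) module) =
    psi ends E ` carrier (mpoly_alg {0..n})"
proof -
  let ?P = "Phi_alg E :: ('k, ('e, 'k) mpoly set) module"
  let ?R = "mpoly_alg {0..n} :: ('k, (nat, 'k) mpoly) module"
  let ?S = "insert \<one>\<^bsub>?P\<^esub> (Y_gen E ends ` {0..n})"
  let ?M = "{m. Poly_Mapping.keys m \<subseteq> {0..n}}"
  interpret R: cring ?R by (rule mpoly_alg_cring)
  interpret h: ring_hom_ring ?R ?P "psi ends E" by (rule psi_ring_hom)
  have car: "carrier ?R = {p. Poly_Mapping.keys p \<subseteq> ?M}"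
    unfolding set_eq_iff mem_carrier_mpoly_alg by blast
  have "gen_subalgebra ?P ?S = psi ends E ` carrier ?R"
  proof
    have "\<one>\<^bsub>?P\<^esub> \<in> psi ends E ` carrier ?R"
      by (rule image_eqI[of _ _ 1]) (simp_all add: psi_one mpoly_alg_const_closed)
    hence "?S \<subseteq> psi ends E ` carrier ?R"
      using Var_carrier[of _ "{0..n}", where 'k = 'k] by (auto simp: Y_gen_eq_psi_Var[OF assms])
    moreover have "subring (psi ends E ` carrier ?R) ?P"
      by (rule h.img_is_subring[OF R.carrier_is_subring])
    moreover have "submodule (psi ends E ` carrier ?R) (ring_of_type_algebra :: 'k ring) ?P"
      unfolding car by (rule psi_image_submodule)
    ultimately show "gen_subalgebra ?P ?S \<subseteq> psi ends E ` carrier ?R"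
      unfolding gen_subalgebra_def by (intro Inter_lower CollectI conjI)
    show "psi ends E ` carrier ?R \<subseteq> gen_subalgebra ?P ?S"
      unfolding gen_subalgebra_def car
    proof (intro Inter_greatest psi_image_subset_submodule)
      fix B and m :: "nat \<Rightarrow>\<^sub>0 nat"
      assume B: "B \<in> {B. submodule B (ring_of_type_algebra :: 'k ring) ?P \<and> subring B ?P \<and> ?S \<subseteq> B}"
      thus "submodule B (ring_of_type_algebra :: 'k ring) ?P" by blast
      assume "m \<in> ?M"
      then obtain vs where vs: "m = (\<Sum>i\<leftarrow>vs. Poly_Mapping.single i 1)" "set vs \<subseteq> {0..n}"
        using monomials_eq_sum_lists[of "{0..n}" "monom_degree m"] by blast
      have "foldr (\<lambda>i y. Y_gen E ends i \<otimes>\<^bsub>?P\<^esub> y) vs \<one>\<^bsub>?P\<^esub> \<in> B"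
        using vs(2)
      proof (induction vs)
        case Nil
        show ?case using B by simp
      next
        case (Cons i vs)
        have "subring B ?P" "Y_gen E ends i \<in> B" using B Cons.prems by auto
        thus ?case using subringE(6)[of B ?P] Cons by simp
      qed
      thus "psi ends E (Poly_Mapping.single m 1) \<in> B"
        unfolding foldr_Y_gen_eq_psi[OF assms] vs(1) .
    qed
  qed
  thus ?thesis by (simp add: K_alg_def)
qed

section \<open>The kernel of \<open>psi\<close> and the induced isomorphism\<close>

lemma mpoly_functional_eq_sum:
  fixes p :: "('x, 'k::comm_ring_1) mpoly"
  assumes "\<And>p q. g (p + q) = g p + g q" "\<And>c p. g (Const c * p) = c * g p"
  shows "g p = (\<Sum>m\<in>Poly_Mapping.keys p. Poly_Mapping.lookup p m * g (Poly_Mapping.single m 1))"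
proof -
  have z: "g 0 = 0" using assms(2)[of 0 0] by simp
  have "g (\<Sum>m\<in>K. Poly_Mapping.single m (Poly_Mapping.lookup p m)) =
      (\<Sum>m\<in>K. Poly_Mapping.lookup p m * g (Poly_Mapping.single m 1))" if "finite K" for K
    using that
    by induction (simp_all add: z assms(1) assms(2)[symmetric] Const_mult_single)
  from this[of "Poly_Mapping.keys p"] show ?thesis by (simp add: sum_single_lookup)
qed

text \<open>Generators are killed because every \<open>?l S\<close> obeys the cut conditions. A
  polynomial outside the ideal is detected by a functional vanishing on the ideal; the spanning
  theorem writes it as a combination of pairings with the \<open>?l S\<close>, which are zero on the
  kernel.\<close>

lemma psi_kernel:
  assumes G: "loopless_multigraph n E ends"
  shows "a_kernel (mpoly_alg {0..n}) (Phi_alg E :: ('k::field_char_0, ('e, 'k) mpoly set) module)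
    (psi ends E) = D_ideal n E ends"
proof
  let ?P = "Phi_alg E :: ('k, ('e, 'k) mpoly set) module"
  let ?V = "{0..n}"
  let ?R = "mpoly_alg ?V :: ('k, (nat, 'k) mpoly) module"
  let ?l = "\<lambda>S a. \<Prod>e\<in>S. edge_form (src ends) (tgt ends) e a :: 'k"
  let ?gen = "\<lambda>I. ((\<Prod>i\<in>I. Var i) - 1) ^ (cut_size E ends I + 1) :: (nat, 'k) mpoly"
  interpret R: cring ?R by (rule mpoly_alg_cring)
  interpret h: ring_hom_ring ?R ?P "psi ends E" by (rule psi_ring_hom)
  interpret D: ideal "D_ideal n E ends" ?R by (rule D_ideal_ideal)
  have E: "finite E" using G by (simp add: loopless_multigraph_def)
  have st: "src ends ` E \<subseteq> ?V" "tgt ends ` E \<subseteq> ?V" using ends_eq_src_tgt(3,4)[OF G] by blast+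
  have ker: "p \<in> a_kernel ?R ?P (psi ends E) \<longleftrightarrow> p \<in> carrier ?R \<and> (\<forall>S\<subseteq>E. pairing (?l S) p = 0)" for p
    unfolding a_kernel_def' mem_Collect_eq psi_eq_zero_iff[OF E] ..
  have gen_closed: "?gen I \<in> carrier ?R" if "I \<subseteq> ?V" for I
    using that by (intro mpoly_alg_pow_carrier mpoly_alg_closed mpoly_alg_prod_closed
        mpoly_alg_const_closed Var_carrier) auto
  have gens_closed: "{?gen I | I. I \<noteq> {} \<and> I \<subseteq> ?V} \<subseteq> carrier ?R"
    using gen_closed by blast
  show "D_ideal n E ends \<subseteq> a_kernel ?R ?P (psi ends E)"
    unfolding D_ideal_def
  proof (rule R.genideal_minimal[OF h.kernel_is_ideal], rule subsetI)
    fix x assume "x \<in> {?gen I | I. I \<noteq> {} \<and> I \<subseteq> ?V}"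
    then obtain I where x: "x = ?gen I" and I: "I \<noteq> {}" "I \<subseteq> ?V" by blast
    have "pairing (?l S) (?gen I) = 0" if S: "S \<subseteq> E" for S
    proof -
      \<comment> \<open>\<open>?l S\<close> reads only end points of edges, all of which lie in
        \<open>?V\<close>, so truncation by \<open>mono_of\<close> does not change it.\<close>
      have "(\<lambda>a. pairing (?l S) (Poly_Mapping.single (mono_of ?V a) 1)) = ?l S"
      proof
        fix a
        have "Poly_Mapping.lookup (mono_of ?V a) (src ends e) = a (src ends e)"
          "Poly_Mapping.lookup (mono_of ?V a) (tgt ends e) = a (tgt ends e)" if "e \<in> S" for e
          using ends_eq_src_tgt(3,4)[OF G subsetD[OF S that]] by (simp_all add: lookup_mono_of)
        thus "pairing (?l S) (Poly_Mapping.single (mono_of ?V a) 1) = ?l S a"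
          by (simp add: pairing_single edge_form_def)
      qed
      \<comment> \<open>At the zero vector the monomial is 1, so the difference there is the pairing
        with the generator itself.\<close>
      moreover have "mono_of ?V (\<lambda>_. 0) = 0" by (simp add: mono_of_def)
      ultimately have "pairing (?l S) (?gen I) = (fdiff I ^^ (cut_size E ends I + 1)) (?l S) (\<lambda>_. 0)"
        using fdiff_pow_functional[of "pairing (?l S)" ?V I "cut_size E ends I + 1" "\<lambda>_. 0",
            OF pairing_diff _ I(2)]
        by (simp del: power_Suc funpow.simps)
      thus ?thesis
        unfolding cut_size_eq_card_cut_edges[OF G] fdiff_pow_edge_prod_subset[OF E S] by simp
    qed
    thus "x \<in> a_kernel ?R ?P (psi ends E)" unfolding x ker using gen_closed[OF I(2)] by blast
  qed
  show "a_kernel ?R ?P (psi ends E) \<subseteq> D_ideal n E ends"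
  proof (rule subsetI, rule ccontr)
    fix p assume p: "p \<in> a_kernel ?R ?P (psi ends E)" and np: "p \<notin> D_ideal n E ends"
    have pc: "p \<in> carrier ?R" and p0: "\<And>S. S \<subseteq> E \<Longrightarrow> pairing (?l S) p = 0" using p ker by blast+
    have D_mult: "r * q \<in> D_ideal n E ends" if "q \<in> D_ideal n E ends" "r \<in> carrier ?R" for q r
      using D.I_l_closed[OF that] by (simp add: mpoly_alg_simps)
    have D_zero: "(0 :: (nat, 'k) mpoly) \<in> D_ideal n E ends"
      using D.zero_closed by (simp add: mpoly_alg_simps)
    have D_add: "p + q \<in> D_ideal n E ends" if "p \<in> D_ideal n E ends" "q \<in> D_ideal n E ends"
      for p q :: "(nat, 'k) mpoly"
      using D.a_closed[OF that] by (simp add: mpoly_alg_simps)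
    have D_smult: "Const c * q \<in> D_ideal n E ends" if "q \<in> D_ideal n E ends"
      for c and q :: "(nat, 'k) mpoly"
      using that by (rule D_mult) (rule mpoly_alg_const_closed)
    obtain g :: "(nat, 'k) mpoly \<Rightarrow> 'k" where g': "\<forall>p q. g (p + q) = g p + g q"
      "\<forall>c p. g (Const c * p) = c * g p" "\<forall>q\<in>D_ideal n E ends. g q = 0" "g p \<noteq> 0"
      using mpoly_separating_functional[OF D_zero _ _ np] D_add D_smult by blast
    note g = g'(1,2)[rule_format] g'(3)[THEN bspec] g'(4)
    have gm: "g (p - q) = g p - g q" for p q using g(1)[of "p - q" q] by simp
    define F where "F = (\<lambda>a. g (Poly_Mapping.single (mono_of ?V a) 1))"
    \<comment> \<open>The iterated difference of \<open>F\<close> at \<open>a\<close> is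
      \<open>g\<close> applied to a monomial multiple of a generator, which lies in the
      ideal.\<close>
    have F0: "(fdiff I ^^ (card (cut_edges (src ends) (tgt ends) E I) + 1)) F = (\<lambda>_. 0)"
      if I: "I \<noteq> {}" "I \<subseteq> ?V" for I
    proof
      fix a
      have "?gen I \<in> D_ideal n E ends"
        unfolding D_ideal_def
        using I by (intro subsetD[OF R.genideal_self[OF gens_closed]]) blast
      moreover have "Poly_Mapping.keys (mono_of ?V a) \<subseteq> ?V"
        by (auto simp: in_keys_iff lookup_mono_of split: if_splits)
      hence "Poly_Mapping.single (mono_of ?V a) 1 \<in> carrier ?R" by (auto simp: mem_carrier_mpoly_alg)
      ultimately have "g (Poly_Mapping.single (mono_of ?V a) 1 * ?gen I) = 0" by (intro g(3) D_mult)
      thus "(fdiff I ^^ (card (cut_edges (src ends) (tgt ends) E I) + 1)) F a = 0"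
        unfolding F_def fdiff_pow_functional[of g, OF gm finite_atLeastAtMost I(2)]
          cut_size_eq_card_cut_edges[OF G] .
    qed
    \<comment> \<open>The singleton sets \<open>I\<close> bound the degree in each variable
      separately.\<close>
    have "F \<in> polyfun ?V"
    proof (rule polyfun_of_fdiff_nilpotent)
      show "F a = F b" if "\<And>i. i \<in> ?V \<Longrightarrow> a i = b i" for a b
        unfolding F_def mono_of_def using that by simp
      show "\<exists>k. (fdiff {i} ^^ k) F = (\<lambda>_. 0)" if "i \<in> ?V" for i
        using F0[of "{i}"] that by blast
    qed simp
    from polyfun_in_edge_span[OF E _ st this F0] obtain c where
      c: "\<And>a. F a = (\<Sum>S\<in>Pow E. c S * ?l S a)" by auto
    have "g p = (\<Sum>m\<in>Poly_Mapping.keys p. Poly_Mapping.lookup p m * g (Poly_Mapping.single m 1))"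
      by (rule mpoly_functional_eq_sum[OF g(1,2)])
    also have "\<dots> = (\<Sum>m\<in>Poly_Mapping.keys p. \<Sum>S\<in>Pow E.
        c S * (Poly_Mapping.lookup p m * ?l S (Poly_Mapping.lookup m)))"
    proof (rule sum.cong[OF refl])
      fix m assume "m \<in> Poly_Mapping.keys p"
      hence "mono_of ?V (Poly_Mapping.lookup m) = m"
        using pc by (intro mono_of_lookup) (auto simp: mem_carrier_mpoly_alg)
      hence "g (Poly_Mapping.single m 1) = (\<Sum>S\<in>Pow E. c S * ?l S (Poly_Mapping.lookup m))"
        using c[of "Poly_Mapping.lookup m"] by (simp add: F_def)
      thus "Poly_Mapping.lookup p m * g (Poly_Mapping.single m 1) =
          (\<Sum>S\<in>Pow E. c S * (Poly_Mapping.lookup p m * ?l S (Poly_Mapping.lookup m)))"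
        by (simp add: sum_distrib_left mult.left_commute)
    qed
    also have "\<dots> = (\<Sum>S\<in>Pow E. c S * pairing (?l S) p)"
      unfolding pairing_def sum_distrib_left by (rule sum.swap)
    also have "\<dots> = 0" using p0 by (intro sum.neutral) simp
    finally show False using g(4) by simp
  qed
qed

theorem theorem3:
  fixes n :: nat and E :: "'e set" and ends :: "'e \<Rightarrow> nat set"
  assumes "loopless_multigraph n E ends"
  shows "filtered_alg_isomorphic
           (D_alg n E ends :: ('k::field_char_0, (nat, 'k) mpoly set) module) (D_filtration n E ends)
           (K_alg n E ends :: ('k, ('e, 'k) mpoly set) module) (K_filtration n E ends)"
proof -
  let ?R = "mpoly_alg {0..n} :: ('k, (nat, 'k) mpoly) module"
  let ?P = "Phi_alg E :: ('k, ('e, 'k) mpoly set) module"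
  let ?D = "D_alg n E ends :: ('k, (nat, 'k) mpoly set) module"
  let ?K = "K_alg n E ends :: ('k, ('e, 'k) mpoly set) module"
  let ?I = "D_ideal n E ends :: (nat, 'k) mpoly set"
  \<comment> \<open>\<open>psi\<close> is constant on each coset of its kernel, so the image of a
    coset is a singleton.\<close>
  let ?f = "\<lambda>B. the_elem (psi ends E ` B) :: ('e, 'k) mpoly set"
  interpret h: ring_hom_ring ?R ?P "psi ends E" by (rule psi_ring_hom)
  have f: "?f (?I +>\<^bsub>?R\<^esub> p) = psi ends E p" if "p \<in> carrier ?R" for p
    using h.the_elem_simp[OF that] by (simp add: psi_kernel[OF assms])
  have "?f \<in> ring_iso (?R Quot ?I) (?P\<lparr>carrier := psi ends E ` carrier ?R\<rparr>)"
    using h.FactRing_iso_set_aux by (simp add: psi_kernel[OF assms])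
  moreover have "?K = ?P\<lparr>carrier := psi ends E ` carrier ?R\<rparr>"
    unfolding carrier_K_alg_eq[OF assms, symmetric] by (simp add: K_alg_def)
  \<comment> \<open>\<open>ring_iso\<close> refers to the ring structure alone, which
    \<open>?D\<close> shares with the quotient ring.\<close>
  ultimately have "?f \<in> ring_iso ?D ?K"
    by (simp add: ring_iso_def ring_hom_def D_alg_def quot_alg_simps)
  moreover have "?f (c \<odot>\<^bsub>?D\<^esub> x) = c \<odot>\<^bsub>?K\<^esub> ?f x" if x: "x \<in> carrier ?D" for c x
  proof -
    obtain p where p: "p \<in> carrier ?R" "x = ?I +>\<^bsub>?R\<^esub> p"
      using x by (auto simp: D_alg_def quot_alg_simps FactRing_def A_RCOSETS_def')
    have "c \<odot>\<^bsub>?D\<^esub> x = ?I +>\<^bsub>?R\<^esub> (Const c * p)"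
      using quot_alg_smult[OF mpoly_alg_algebra D_ideal_ideal _ p(1), of c]
      by (simp add: p(2) D_alg_def mpoly_alg_simps ring_of_type_algebra_def)
    thus ?thesis
      using p by (simp add: f mpoly_alg_closed mpoly_alg_const_closed psi_smult K_alg_def)
  qed
  \<comment> \<open>Both pieces are images of the same set of polynomials, under the coset map and
    under \<open>psi\<close>.\<close>
  moreover have "?f ` D_filtration n E ends k = K_filtration n E ends k" for k
  proof -
    have "D_filtration n E ends k = (\<lambda>p. ?I +>\<^bsub>?R\<^esub> p) ` {p \<in> carrier ?R. total_degree_le k p}"
      by (auto simp: D_filtration_def)
    thus ?thesis unfolding K_filtration_eq[OF assms] by (simp add: image_image f cong: image_cong_simp)
  qed
  ultimately show ?thesis
    unfolding filtered_alg_isomorphic_def filtered_alg_iso_def by blast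
qed

end
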